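(* Let $n$ be a positive integer. (1) For any positive integer $N$ and any polynomial $f\in\mathbb{R}[Y_1,\dots,Y_n]$ of degree at most $2N-1$, the following cubature formulas are exact: $$\int_{\mathfrak{F}}f(Y)\,\omega^{I,+}(Y)\,dY=\left(\frac{1}{N}\right)^n\sum_{Y\in \mathfrak{F}_N^{\mathrm{II},+}}\mathcal{H}_Y^{-1}f(Y),$$ $$\int_{\mathfrak{F}}f(Y)\,\omega^{III,+}(Y)\,dY=\left(\frac{2}{2N+1}\right)^n\sum_{Y\in \mathfrak{F}_N^{\mathrm{VIII},+}}\mathcal{H}_Y^{-1}f(Y)\,\mathcal{J}^{III,+}(Y).$$ (2) For any positive integer $N$ and any polynomial $f\in\mathbb{R}[Y_1,\dots,Y_n]$ of degree at most $2(N-n)+1$, the following cubature formulas are exact: $$\int_{\mathfrak{F}}f(Y)\,\omega^{I,-}(Y)\,dY=\left(\frac{1}{N}\right)^n\sum_{Y\in \mathfrak{F}_N^{\mathrm{II},-}}f(Y)\,\mathcal{J}^{I,-}(Y),$$ $$\int_{\mathfrak{F}}f(Y)\,\omega^{III,-}(Y)\,dY=\left(\frac{2}{2N+1}\right)^n\sum_{Y\in \mathfrak{F}_N^{\mathrm{VIII},-}}f(Y)\,\mathcal{J}^{III,-}(Y).$$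
   Context: For $\lambda,x\in\mathbb{R}^n$: $\cos^-_\lambda(x)=\sum_{\sigma\in S_n}\mathrm{sgn}(\sigma)\prod_{i=1}^n\cos(\pi\lambda_{\sigma(i)}x_i)$ and $\cos^+_\lambda(x)=\sum_{\sigma\in S_n}\prod_{i=1}^n\cos(\pi\lambda_{\sigma(i)}x_i)$. Put $\rho=(\frac12,\dots,\frac12)$, $\rho_1=(n-1,n-2,\dots,0)$, $\rho_2=(n-\frac12,n-\frac32,\dots,\frac12)$. $F=\{x\in\mathbb{R}^n : 1\ge x_1\ge x_2\ge\dots\ge x_n\ge0\}$. Let $X_j(x)=\cos^+_{(1,\dots,1,0,\dots,0)}(x)$ with $j$ ones and $n-j$ zeros, $j=1,\dots,n$; let $\varphi(x)=(X_1(x),\dots,X_n(x))$ for $x\in F$ and $\mathfrak{F}=\varphi(F)$. The map $\varphi$ is injective on $F$. Let $J(x)=\det\frac{\partial(X_1,\dots,X_n)}{\partial(x_1,\dots,x_n)}$. Then $J(x)^2=p^{I,+}(\varphi(x))$ for a polynomial $p^{I,+}$, and $\mathcal{J}(Y)=\sqrt{p^{I,+}(Y)}$ for $Y\in\mathfrak{F}$, so $\mathcal{J}(\varphi(x))=|J(x)|$ for $x\in F$. The polynomials $\mathcal{J}^{I,-},\mathcal{J}^{III,+},\mathcal{J}^{III,-}\in\mathbb{R}[Y_1,\dots,Y_n]$ are determined by $\mathcal{J}^{I,-}(\varphi(x))=\cos^-_{\rho_1}(x)^2$, $\mathcal{J}^{III,+}(\varphi(x))=\cos^+_{\rho}(x)^2$,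 $\mathcal{J}^{III,-}(\varphi(x))=\cos^-_{\rho_2}(x)^2$. The weight functions are $\omega^{I,+}=1/\mathcal{J}$, $\omega^{I,-}=\mathcal{J}^{I,-}/\mathcal{J}$, $\omega^{III,+}=\mathcal{J}^{III,+}/\mathcal{J}$, $\omega^{III,-}=\mathcal{J}^{III,-}/\mathcal{J}$. Let $D_N^+=\{r\in\mathbb{Z}^n : N-1\ge r_1\ge\dots\ge r_n\ge0\}$ and $D_N^-=\{r\in\mathbb{Z}^n : N-1\ge r_1>\dots>r_n\ge0\}$. Grids: $F_N^{\mathrm{II},\pm}=\left\{\left(\frac{r_1+\frac12}{N},\dots,\frac{r_n+\frac12}{N}\right): r\in D_N^\pm\right\}$, $F_N^{\mathrm{VIII},\pm}=\left\{\left(\frac{2(r_1+\frac12)}{2N+1},\dots,\frac{2(r_n+\frac12)}{2N+1}\right): r\in D_N^\pm\right\}$, and $\mathfrak{F}_N^{t,\pm}=\varphi(F_N^{t,\pm})$ for $t\in\{\mathrm{II},\mathrm{VIII}\}$. For $Y=\varphi(s)$ with $s$ in one of these grids, $\mathcal{H}_Y=H_s=\#\{\sigma\in S_n : (s_{\sigma(1)},\dots,s_{\sigma(n)})=s\}$. *)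

theory Defs
  imports
    "HOL-Analysis.Analysis"
    "HOL-Combinatorics.Permutations"
    "HOL-Library.Poly_Mapping"
begin

text \<open>
  The dimension \<open>n\<close> is \<open>CARD('n)\<close>; the order on the index type \<open>'n\<close> plays the role of the order
  of the indices \<open>1 < \<dots> < n\<close>. Every positive \<open>n\<close> is the cardinality of such a type.
\<close>

subsection \<open>Polynomials in the variables \<open>Y\<^sub>1, \<dots>, Y\<^sub>n\<close>\<close>

text \<open>A polynomial maps each exponent vector to its coefficient.\<close>

type_synonym 'n rpoly = "('n \<Rightarrow>\<^sub>0 nat) \<Rightarrow>\<^sub>0 real"

definition eval_rpoly :: "'n::finite rpoly \<Rightarrow> real^'n \<Rightarrow> real" where
  "eval_rpoly p Y = (\<Sum>m\<in>Poly_Mapping.keys p.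
     Poly_Mapping.lookup p m * (\<Prod>i\<in>UNIV. (Y $ i) ^ Poly_Mapping.lookup m i))"

text \<open>
  Total degree. The bound is an integer because \<open>2(N - n) + 1\<close> may be negative, in which case
  only the zero polynomial satisfies it.
\<close>

definition degree_at_most :: "'n::finite rpoly \<Rightarrow> int \<Rightarrow> bool" where
  "degree_at_most p d \<longleftrightarrow>
     (\<forall>m\<in>Poly_Mapping.keys p. int (\<Sum>i\<in>UNIV. Poly_Mapping.lookup m i) \<le> d)"

subsection \<open>Symmetric and antisymmetric multivariate cosines\<close>

definition cos_minus :: "real^'n \<Rightarrow> real^'n \<Rightarrow> real" where
  "cos_minus l x = (\<Sum>\<sigma> | \<sigma> permutes (UNIV :: 'n set).
     of_int (sign \<sigma>) * (\<Prod>i\<in>UNIV. cos (pi * l $ (\<sigma> i) * x $ i)))"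

definition cos_plus :: "real^'n \<Rightarrow> real^'n \<Rightarrow> real" where
  "cos_plus l x = (\<Sum>\<sigma> | \<sigma> permutes (UNIV :: 'n set).
     (\<Prod>i\<in>UNIV. cos (pi * l $ (\<sigma> i) * x $ i)))"

definition rho :: "real^'n" where
  "rho = (\<chi> i. 1/2)"

text \<open>For the \<open>k\<close>-th index \<open>i\<close>, the set \<open>{j. i < j}\<close> has \<open>n - k\<close> elements.\<close>

definition rho1 :: "real^'n::{finite,wellorder}" where
  "rho1 = (\<chi> i. real (card {j. i < j}))"

definition rho2 :: "real^'n::{finite,wellorder}" where
  "rho2 = (\<chi> i. real (card {j. i < j}) + 1/2)"

subsection \<open>The map \<open>\<phi>\<close>, its domain and its Jacobian determinant\<close>

definition F :: "(real^'n::{finite,wellorder}) set" where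
  "F = {x. (\<forall>i. 0 \<le> x $ i \<and> x $ i \<le> 1) \<and> (\<forall>i j. i \<le> j \<longrightarrow> x $ j \<le> x $ i)}"

definition X :: "'n::{finite,wellorder} \<Rightarrow> real^'n::_ \<Rightarrow> real" where
  "X j = cos_plus (\<chi> i. if i \<le> j then 1 else 0)"

definition phi :: "real^'n::{finite,wellorder} \<Rightarrow> real^'n::_" where
  "phi x = (\<chi> j. X j x)"

definition FF :: "(real^'n::{finite,wellorder}) set" where
  "FF = phi ` F"

definition J :: "real^'n::{finite,wellorder} \<Rightarrow> real" where
  "J x = det (jacobian phi (at x))"

subsection \<open>Weight functions\<close>

text \<open>
  The polynomial \<open>p\<close> with \<open>p(\<phi>(x)) = g(x)\<close> on \<open>F\<close>. It is only used for \<open>g\<close> for which such a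
  polynomial exists; it is then unique because \<open>\<phi>(F)\<close> has nonempty interior.
\<close>

definition poly_via_phi :: "(real^'n::{finite,wellorder} \<Rightarrow> real) \<Rightarrow> 'n rpoly" where
  "poly_via_phi g = (THE p. \<forall>x\<in>F. eval_rpoly p (phi x) = g x)"

definition p_I_plus :: "'n::{finite,wellorder} rpoly" where
  "p_I_plus = poly_via_phi (\<lambda>x. (J x)\<^sup>2)"

definition JJ :: "real^'n::{finite,wellorder} \<Rightarrow> real" where
  "JJ Y = sqrt (eval_rpoly p_I_plus Y)"

definition J_I_minus :: "'n::{finite,wellorder} rpoly" where
  "J_I_minus = poly_via_phi (\<lambda>x. (cos_minus rho1 x)\<^sup>2)"

definition J_III_plus :: "'n::{finite,wellorder} rpoly" where
  "J_III_plus = poly_via_phi (\<lambda>x. (cos_plus rho x)\<^sup>2)"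

definition J_III_minus :: "'n::{finite,wellorder} rpoly" where
  "J_III_minus = poly_via_phi (\<lambda>x. (cos_minus rho2 x)\<^sup>2)"

text \<open>
  On the null subset of \<open>\<phi>(F)\<close> where \<^term>\<open>JJ\<close> vanishes, these quotients are \<open>0\<close> by
  convention; this does not affect integrals.
\<close>

definition omega_I_plus :: "real^'n::{finite,wellorder} \<Rightarrow> real" where
  "omega_I_plus Y = 1 / JJ Y"

definition omega_I_minus :: "real^'n::{finite,wellorder} \<Rightarrow> real" where
  "omega_I_minus Y = eval_rpoly J_I_minus Y / JJ Y"

definition omega_III_plus :: "real^'n::{finite,wellorder} \<Rightarrow> real" where
  "omega_III_plus Y = eval_rpoly J_III_plus Y / JJ Y"

definition omega_III_minus :: "real^'n::{finite,wellorder} \<Rightarrow> real" where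
  "omega_III_minus Y = eval_rpoly J_III_minus Y / JJ Y"

subsection \<open>Grids\<close>

definition D_plus :: "nat \<Rightarrow> (int^'n::{finite,wellorder}) set" where
  "D_plus N = {r. (\<forall>i. 0 \<le> r $ i \<and> r $ i \<le> int N - 1) \<and> (\<forall>i j. i < j \<longrightarrow> r $ j \<le> r $ i)}"

definition D_minus :: "nat \<Rightarrow> (int^'n::{finite,wellorder}) set" where
  "D_minus N = {r. (\<forall>i. 0 \<le> r $ i \<and> r $ i \<le> int N - 1) \<and> (\<forall>i j. i < j \<longrightarrow> r $ j < r $ i)}"

definition node_II :: "nat \<Rightarrow> int^'n \<Rightarrow> real^'n" where
  "node_II N r = (\<chi> i. (of_int (r $ i) + 1/2) / real N)"

definition node_VIII :: "nat \<Rightarrow> int^'n \<Rightarrow> real^'n" where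
  "node_VIII N r = (\<chi> i. 2 * (of_int (r $ i) + 1/2) / (2 * real N + 1))"

definition F_II_plus :: "nat \<Rightarrow> (real^'n::{finite,wellorder}) set" where
  "F_II_plus N = node_II N ` D_plus N"

definition F_II_minus :: "nat \<Rightarrow> (real^'n::{finite,wellorder}) set" where
  "F_II_minus N = node_II N ` D_minus N"

definition F_VIII_plus :: "nat \<Rightarrow> (real^'n::{finite,wellorder}) set" where
  "F_VIII_plus N = node_VIII N ` D_plus N"

definition F_VIII_minus :: "nat \<Rightarrow> (real^'n::{finite,wellorder}) set" where
  "F_VIII_minus N = node_VIII N ` D_minus N"

definition FF_II_plus :: "nat \<Rightarrow> (real^'n::{finite,wellorder}) set" where
  "FF_II_plus N = phi ` F_II_plus N"

definition FF_II_minus :: "nat \<Rightarrow> (real^'n::{finite,wellorder}) set" where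
  "FF_II_minus N = phi ` F_II_minus N"

definition FF_VIII_plus :: "nat \<Rightarrow> (real^'n::{finite,wellorder}) set" where
  "FF_VIII_plus N = phi ` F_VIII_plus N"

definition FF_VIII_minus :: "nat \<Rightarrow> (real^'n::{finite,wellorder}) set" where
  "FF_VIII_minus N = phi ` F_VIII_minus N"

definition H :: "real^'n \<Rightarrow> nat" where
  "H s = card {\<sigma>. \<sigma> permutes (UNIV :: 'n set) \<and> (\<chi> i. s $ (\<sigma> i)) = s}"

text \<open>All grids lie in \<^term>\<open>F\<close>, on which \<^term>\<open>phi\<close> is injective.\<close>

definition HH :: "real^'n::{finite,wellorder} \<Rightarrow> nat" where
  "HH Y = H (the_inv_into F phi Y)"

end

theory Submission
  imports Defs
begin

text \<open>
  The map \<^const>\<open>phi\<close> expresses multiples of the elementary symmetric polynomials in the cosines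
  \<open>c\<^sub>i = cos (\<pi> x\<^sub>i)\<close>. Substituting \<open>Y = \<phi>(x)\<close> cancels the denominator of the weight function
  against the Jacobian determinant, so each integral over \<open>\<phi>(F)\<close> becomes the integral over \<open>F\<close> of
  \<open>f(\<phi>(x)) W(x)\<close>, where \<open>W\<close> is one of \<open>1\<close>, \<open>cos\<^sup>+\<^sub>\<rho>(x)\<^sup>2\<close>, \<open>cos\<^sup>-\<^sub>\<rho>\<^sub>1(x)\<^sup>2\<close> and \<open>cos\<^sup>-\<^sub>\<rho>\<^sub>2(x)\<^sup>2\<close>
  (\<open>integral_FF\<close>). This function is symmetric in the coordinates, and \<open>F\<close> is a fundamental domain for
  the permutations of the coordinates of the cube \<open>[0,1]\<^sup>n\<close>. Hence \<open>n!\<close> times the integral over \<open>F\<close> is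
  the integral over the cube, and in the same way \<open>n!\<close> times the sum over the grid points \<open>s\<close> in
  \<open>F\<close>, weighted with \<open>1/H\<^sub>s\<close>, is the sum over the full product grid; both rest on the fact that \<open>x\<close>
  has exactly \<open>H\<^sub>x\<close> sorting permutations (\<open>card_sorting_permutations\<close>).

  On the cube and on the product grid the function is a linear combination of products of functions
  of a single coordinate, so only a quadrature rule in one variable is left (\<open>cubature_FF\<close>). Each
  \<open>X\<^sub>j\<close> has degree at most one in every \<open>c\<^sub>i\<close>, so \<open>f\<close> contributes at most the power \<open>deg f\<close> of each
  \<open>c\<^sub>i\<close>. The four weights contribute products of two cosines, of total frequency at most \<open>0\<close>, \<open>1\<close>,
  \<open>2n - 2\<close> and \<open>2n - 1\<close>. The midpoint rule with \<open>N\<close> nodes is exact for frequencies up to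
  \<open>2N - 1\<close>. The \<open>N\<close> nodes of type VIII, together with the end point \<open>1\<close> at half the weight, are
  exact for frequencies up to \<open>2N\<close>; the end point disappears because a weight with half-integral
  frequencies vanishes there. Comparing frequencies gives the two bounds on the degree.

  Behind this are three properties of \<open>\<phi>\<close>. The squares of \<open>J\<close>, \<open>cos\<^sup>-\<^sub>\<rho>\<^sub>1\<close> and
  \<open>cos\<^sup>-\<^sub>\<rho>\<^sub>2\<close> are polynomials in the \<open>X\<^sub>j\<close> because they have the form \<open>(det A)\<^sup>2 = det (A\<^sup>T A)\<close>, where the
  entries of \<open>A\<^sup>T A\<close> are sums over the coordinates of one and the same polynomial in \<open>c\<^sub>i\<close>; such sums
  are combinations of power sums, which are polynomials in the \<open>X\<^sub>j\<close> by Newton's identities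
  (\<open>poly_in_phi_det_squared\<close>). The square of \<open>cos\<^sup>+\<^sub>\<rho>\<close> is a multiple of \<open>\<Prod>(1 + c\<^sub>i)\<close>. The map is injective on \<open>F\<close> because power sums
  determine how often each value occurs (\<open>inj_on_phi\<close>); by invariance of domain \<open>\<phi>(F)\<close> then has
  interior points, which makes these polynomials unique (\<open>rpoly_eqI_phi\<close>). Finally the Jacobian
  determinant has no zero in \<open>F\<close> outside its boundary, a null set (\<open>J_nonzero\<close>).
\<close>

section \<open>Elementary symmetric polynomials\<close>

text \<open>
  The coefficients of \<open>\<Prod>(1 + c\<^sub>i t)\<close>. This form makes deletion of one index a division by a linear
  factor, and Newton's identities the product rule.
\<close>
definition esym :: "('a \<Rightarrow> real) \<Rightarrow> 'a set \<Rightarrow> nat \<Rightarrow> real" where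
  "esym c A k = coeff (\<Prod>i\<in>A. [:1, c i:]) k"

lemma esym_0 [simp]: "esym c A 0 = 1"
  by (simp add: esym_def flip: poly_0_coeff_0) (simp add: poly_prod)

lemma esym_insert:
  assumes "finite A" "a \<notin> A"
  shows "esym c (insert a A) (Suc k) = esym c A (Suc k) + c a * esym c A k"
  using assms by (simp add: esym_def)

lemma esym_remove:
  assumes "finite A" "j \<in> A"
  shows "esym c A (Suc k) = esym c (A - {j}) (Suc k) + c j * esym c (A - {j}) k"
  using esym_insert[of "A - {j}" j c k] assms by (simp add: insert_absorb)

lemma esym_eq_sum_subsets:
  assumes "finite A"
  shows "esym c A k = (\<Sum>S | S \<subseteq> A \<and> card S = k. \<Prod>i\<in>S. c i)"
proof -
  have "(\<Prod>i\<in>A. [:1, c i:]) = (\<Prod>i\<in>A. [:0, c i:] + 1)"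
    by (intro prod.cong refl) (simp add: one_pCons)
  also have "\<dots> = (\<Sum>S\<in>Pow A. \<Prod>i\<in>S. [:0, c i:])"
    using prod_add[OF assms, of "\<lambda>i. [:0, c i:]" "\<lambda>_. 1"] by simp
  also have "\<dots> = (\<Sum>S\<in>Pow A. monom (\<Prod>i\<in>S. c i) (card S))"
  proof (intro sum.cong refl)
    fix S assume "S \<in> Pow A"
    then have "finite S" using assms finite_subset by auto
    then show "(\<Prod>i\<in>S. [:0, c i:]) = monom (\<Prod>i\<in>S. c i) (card S)"
    proof induction
      case (insert a S)
      have "[:0, c a:] = monom (c a) 1" by (simp add: monom_Suc monom_0)
      then show ?case using insert by (simp add: mult_monom)
    qed simp
  qed
  finally have "esym c A k = (\<Sum>S\<in>Pow A. if card S = k then \<Prod>i\<in>S. c i else 0)"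
    by (simp add: esym_def coeff_sum)
  also have "\<dots> = (\<Sum>S | S \<subseteq> A \<and> card S = k. \<Prod>i\<in>S. c i)"
    using sum.inter_filter[of "Pow A" "\<lambda>S. \<Prod>i\<in>S. c i" "\<lambda>S. card S = k"] assms by simp
  finally show ?thesis .
qed

text \<open>
  Both sides are the coefficient of \<open>t\<^sup>k\<close> in the derivative of \<open>\<Prod>(1 + c\<^sub>i t)\<close>.
\<close>
lemma esym_newton:
  assumes "finite A"
  shows "real (Suc k) * esym c A (Suc k) = (\<Sum>j\<in>A. c j * esym c (A - {j}) k)"
proof -
  have "real (Suc k) * esym c A (Suc k) = coeff (pderiv (\<Prod>i\<in>A. [:1, c i:])) k"
    by (simp add: esym_def coeff_pderiv)
  also have "\<dots> = (\<Sum>j\<in>A. c j * esym c (A - {j}) k)"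
    by (simp add: pderiv_prod pderiv_pCons coeff_sum esym_def mult.commute)
  finally show ?thesis .
qed

text \<open>
  Dividing \<open>\<Prod>(1 + c\<^sub>i t)\<close> by \<open>1 + c\<^sub>j t\<close> is multiplication by the geometric series
  \<open>\<Sum>(-c\<^sub>j t)\<^sup>m\<close>. So the elementary symmetric polynomials without the index \<open>j\<close> are polynomials in
  \<open>c\<^sub>j\<close> over the full elementary symmetric polynomials.
\<close>
lemma esym_remove_expand:
  assumes "finite A" "j \<in> A"
  shows "esym c (A - {j}) k = (\<Sum>m\<le>k. (- c j) ^ m * esym c A (k - m))"
proof (induction k)
  case (Suc k)
  have "esym c (A - {j}) (Suc k) = esym c A (Suc k) + (- c j) * esym c (A - {j}) k"
    using esym_remove[OF assms, of c k] by simp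
  also have "\<dots> = (\<Sum>m\<le>Suc k. (- c j) ^ m * esym c A (Suc k - m))"
    unfolding Suc by (simp add: sum.atMost_Suc_shift sum_distrib_left mult.assoc del: sum.atMost_Suc)
  finally show ?case .
qed simp

text \<open>
  The chain rule, for \<open>c\<^sub>j\<close> that depend on the coordinate \<open>j\<close> only, with derivative \<open>d\<^sub>j\<close>: the partial derivative of
  an elementary symmetric polynomial in \<open>c\<^sub>j\<close> is the one of lower degree in the other variables.
\<close>
lemma esym_has_derivative:
  fixes x :: "real^'n"
  assumes "finite A" and c: "\<And>i. i \<in> A \<Longrightarrow> ((\<lambda>x. c x i) has_derivative (\<lambda>h. d i * h $ i)) (at x)"
  shows "((\<lambda>x. esym (c x) A (Suc k)) has_derivative
           (\<lambda>h. \<Sum>j\<in>A. d j * esym (c x) (A - {j}) k * h $ j)) (at x)"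
  using assms
proof (induction A arbitrary: k rule: finite_induct)
  case empty
  have "esym b {} (Suc k) = 0" for b :: "'n \<Rightarrow> real" by (simp add: esym_def)
  then show ?case by simp
next
  case (insert a A)
  note ca = insert.prems[of a, simplified]
  note IH = insert.IH[OF insert.prems, simplified]
  have rem: "esym b (insert a A - {j}) (Suc k) = esym b (A - {j}) (Suc k) + b a * esym b (A - {j}) k"
    if "j \<in> A" for j k and b :: "'n \<Rightarrow> real"
  proof -
    from that insert.hyps have eq: "insert a A - {j} = insert a (A - {j})" by auto
    show ?thesis unfolding eq using insert.hyps by (intro esym_insert) auto
  qed
  have rem0: "insert a A - {a} = A" using insert.hyps by auto
  show ?case
  proof (cases k)
    case 0
    have "((\<lambda>x. esym (c x) A (Suc 0) + c x a * 1) has_derivative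
             (\<lambda>h. (\<Sum>j\<in>A. d j * esym (c x) (A - {j}) 0 * h $ j) + d a * h $ a * 1)) (at x)"
      by (intro has_derivative_add has_derivative_mult_left IH ca)
    then show ?thesis using insert.hyps by (simp add: 0 esym_insert add.commute)
  next
    case (Suc k')
    have "((\<lambda>x. esym (c x) A (Suc (Suc k')) + c x a * esym (c x) A (Suc k')) has_derivative
             (\<lambda>h. (\<Sum>j\<in>A. d j * esym (c x) (A - {j}) (Suc k') * h $ j) +
                 (c x a * (\<Sum>j\<in>A. d j * esym (c x) (A - {j}) k' * h $ j) + d a * h $ a * esym (c x) A (Suc k')))) (at x)"
      by (intro has_derivative_add has_derivative_mult IH ca)
    moreover have "(\<Sum>j\<in>insert a A. d j * esym (c x) (insert a A - {j}) (Suc k') * h $ j)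
      = (\<Sum>j\<in>A. d j * esym (c x) (A - {j}) (Suc k') * h $ j) +
                 (c x a * (\<Sum>j\<in>A. d j * esym (c x) (A - {j}) k' * h $ j) + d a * h $ a * esym (c x) A (Suc k'))" for h
      using insert.hyps
      by (simp add: rem0 rem sum.distrib sum_distrib_left algebra_simps cong: sum.cong)
    ultimately show ?thesis by (simp only: Suc esym_insert[OF insert.hyps])
  qed
qed

text \<open>
  This identifies \<open>X\<^sub>j\<close>. The permutations are grouped by the preimage \<open>S\<close> of \<open>A\<close>, which runs through
  all sets of the cardinality of \<open>A\<close>. All groups have the same size: composition with a permutation that carries
  \<open>S\<close> to \<open>A\<close> is a bijection between the groups of \<open>A\<close> and \<open>S\<close>.
\<close>
lemma sum_permutations_prod_vimage:
  fixes c :: "'n::finite \<Rightarrow> real"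
  shows "(\<Sum>\<sigma> | \<sigma> permutes (UNIV :: 'n set). \<Prod>i\<in>\<sigma> -` A. c i)
    = real (card {\<sigma>. \<sigma> permutes (UNIV :: 'n set) \<and> \<sigma> -` A = A}) * esym c UNIV (card A)"
proof -
  let ?P = "{\<sigma>. \<sigma> permutes (UNIV :: 'n set)}"
  have card_vimage: "card (\<sigma> -` A) = card A" if "\<sigma> permutes UNIV" for \<sigma>
    using that by (intro card_vimage_inj) (auto simp: permutes_inj permutes_surj)
  have fiber: "card {\<sigma>. \<sigma> permutes (UNIV :: 'n set) \<and> \<sigma> -` A = S}
      = card {\<sigma>. \<sigma> permutes (UNIV :: 'n set) \<and> \<sigma> -` A = A}" if S: "card S = card A" for S
  proof -
    have "card (- S) = card (- A)" using S by (simp add: Compl_eq_Diff_UNIV card_Diff_subset)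
    then obtain g h where g: "bij_betw g S A" and h: "bij_betw h (- S) (- A)"
      using S by (meson finite finite_same_card_bij)
    define \<tau> where "\<tau> = (\<lambda>i. if i \<in> S then g i else h i)"
    have "bij_betw \<tau> (S \<union> - S) (A \<union> - A)"
    proof (rule bij_betw_combine)
      show "bij_betw \<tau> S A" using g by (subst bij_betw_cong[of S \<tau> g]) (auto simp: \<tau>_def)
      show "bij_betw \<tau> (- S) (- A)" using h by (subst bij_betw_cong[of "- S" \<tau> h]) (auto simp: \<tau>_def)
    qed auto
    then have \<tau>: "\<tau> permutes UNIV" by (intro bij_imp_permutes) auto
    have \<tau>S: "\<tau> ` S = A" using g by (auto simp: \<tau>_def bij_betw_def)
    then have \<tau>A: "\<tau> -` A = S" using permutes_inj[OF \<tau>] by (metis inj_vimage_image_eq)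
    have inv: "inv \<tau> permutes UNIV" "inv \<tau> -` S = A"
      using \<tau> \<tau>S bij_vimage_eq_inv_image[OF permutes_bij[OF permutes_inv[OF \<tau>]], of S]
      by (simp_all add: permutes_inv inv_inv_eq permutes_bij)
    have "bij_betw (\<lambda>\<pi>. \<pi> \<circ> \<tau>) {\<sigma>. \<sigma> permutes (UNIV :: 'n set) \<and> \<sigma> -` A = A}
        {\<sigma>. \<sigma> permutes (UNIV :: 'n set) \<and> \<sigma> -` A = S}"
    proof (rule bij_betwI[where g = "\<lambda>\<pi>. \<pi> \<circ> inv \<tau>"])
      show "(\<lambda>\<pi>. \<pi> \<circ> \<tau>) \<in> {\<sigma>. \<sigma> permutes (UNIV :: 'n set) \<and> \<sigma> -` A = A} \<rightarrow> {\<sigma>. \<sigma> permutes (UNIV :: 'n set) \<and> \<sigma> -` A = S}"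
        by (intro Pi_I CollectI conjI permutes_compose[OF \<tau>]) (simp_all only: vimage_comp[symmetric] \<tau>A mem_Collect_eq)
      show "(\<lambda>\<pi>. \<pi> \<circ> inv \<tau>) \<in> {\<sigma>. \<sigma> permutes (UNIV :: 'n set) \<and> \<sigma> -` A = S} \<rightarrow> {\<sigma>. \<sigma> permutes (UNIV :: 'n set) \<and> \<sigma> -` A = A}"
        by (intro Pi_I CollectI conjI permutes_compose[OF inv(1)]) (simp_all only: vimage_comp[symmetric] inv(2) mem_Collect_eq)
    qed (simp_all add: comp_assoc permutes_inv_o[OF \<tau>])
    then show ?thesis by (simp add: bij_betw_same_card)
  qed
  have "(\<Sum>\<sigma>\<in>?P. \<Prod>i\<in>\<sigma> -` A. c i)
      = (\<Sum>S | S \<subseteq> UNIV \<and> card S = card A. \<Sum>\<sigma> | \<sigma> \<in> ?P \<and> \<sigma> -` A = S. \<Prod>i\<in>\<sigma> -` A. c i)"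
    by (rule sum.group[symmetric]) (auto simp: card_vimage finite_permutations)
  also have "\<dots> = (\<Sum>S | S \<subseteq> UNIV \<and> card S = card A.
      real (card {\<sigma>. \<sigma> permutes (UNIV :: 'n set) \<and> \<sigma> -` A = A}) * (\<Prod>i\<in>S. c i))"
  proof (intro sum.cong refl)
    fix S :: "'n set" assume "S \<in> {S. S \<subseteq> UNIV \<and> card S = card A}"
    then have S: "card S = card A" by simp
    have "(\<Sum>\<sigma> | \<sigma> \<in> ?P \<and> \<sigma> -` A = S. \<Prod>i\<in>\<sigma> -` A. c i)
        = (\<Sum>\<sigma> | \<sigma> permutes UNIV \<and> \<sigma> -` A = S. \<Prod>i\<in>S. c i)"
      by (intro sum.cong) auto
    then show "(\<Sum>\<sigma> | \<sigma> \<in> ?P \<and> \<sigma> -` A = S. \<Prod>i\<in>\<sigma> -` A. c i)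
        = real (card {\<sigma>. \<sigma> permutes (UNIV :: 'n set) \<and> \<sigma> -` A = A}) * (\<Prod>i\<in>S. c i)"
      by (simp only: sum_constant fiber[OF S])
  qed
  finally show ?thesis by (simp add: esym_eq_sum_subsets sum_distrib_left)
qed

section \<open>Evaluation of polynomials\<close>

lemma eval_rpoly_superset:
  assumes "finite M" "Poly_Mapping.keys p \<subseteq> M"
  shows "eval_rpoly p Y = (\<Sum>m\<in>M. Poly_Mapping.lookup p m * (\<Prod>i\<in>UNIV. (Y $ i) ^ Poly_Mapping.lookup m i))"
  unfolding eval_rpoly_def using assms
  by (intro sum.mono_neutral_left) (auto simp: in_keys_iff)

lemma eval_rpoly_add: "eval_rpoly (p + q) Y = eval_rpoly p Y + eval_rpoly q Y"
  using keys_add[of p q]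
  by (simp add: eval_rpoly_superset[of "Poly_Mapping.keys p \<union> Poly_Mapping.keys q"]
      lookup_add distrib_right sum.distrib)

lemma eval_rpoly_zero [simp]: "eval_rpoly 0 Y = 0"
  by (simp add: eval_rpoly_def)

lemma eval_rpoly_sum: "eval_rpoly (\<Sum>a\<in>A. p a) Y = (\<Sum>a\<in>A. eval_rpoly (p a) Y)"
  by (induction A rule: infinite_finite_induct) (auto simp: eval_rpoly_add)

lemma eval_rpoly_single:
  "eval_rpoly (Poly_Mapping.single m a) Y = a * (\<Prod>i\<in>UNIV. (Y $ i) ^ Poly_Mapping.lookup m i)"
  by (subst eval_rpoly_superset[of "{m}"]) auto

lemma rpoly_eq_sum_single:
  "p = (\<Sum>m\<in>Poly_Mapping.keys p. Poly_Mapping.single m (Poly_Mapping.lookup p m))"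
proof (rule poly_mapping_eqI)
  fix k
  show "Poly_Mapping.lookup p k =
    Poly_Mapping.lookup (\<Sum>m\<in>Poly_Mapping.keys p. Poly_Mapping.single m (Poly_Mapping.lookup p m)) k"
    by (cases "k \<in> Poly_Mapping.keys p") (auto simp: lookup_sum lookup_single when_def in_keys_iff)
qed

lemma eval_rpoly_mult: "eval_rpoly (p * q) Y = eval_rpoly p Y * eval_rpoly q Y"
proof -
  let ?s = "\<lambda>p m. Poly_Mapping.single m (Poly_Mapping.lookup p m)"
  have "p * q = (\<Sum>m\<in>Poly_Mapping.keys p. ?s p m) * (\<Sum>m\<in>Poly_Mapping.keys q. ?s q m)"
    by (simp flip: rpoly_eq_sum_single)
  also have "eval_rpoly \<dots> Y = (\<Sum>m\<in>Poly_Mapping.keys p. eval_rpoly (?s p m) Y) * (\<Sum>m\<in>Poly_Mapping.keys q. eval_rpoly (?s q m) Y)"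
    by (simp add: sum_product eval_rpoly_sum mult_single eval_rpoly_single lookup_add power_add
        prod.distrib mult_ac)
  also have "\<dots> = eval_rpoly p Y * eval_rpoly q Y"
    by (simp flip: eval_rpoly_sum rpoly_eq_sum_single)
  finally show ?thesis .
qed

section \<open>Symmetric functions of the cosines as polynomials\<close>

definition poly_in_phi :: "(real^'n::{finite,wellorder} \<Rightarrow> real) \<Rightarrow> bool" where
  "poly_in_phi g \<longleftrightarrow> (\<exists>p. \<forall>x. eval_rpoly p (phi x) = g x)"

lemma poly_in_phi_const: "poly_in_phi (\<lambda>x. a)"
  unfolding poly_in_phi_def by (rule exI[of _ "Poly_Mapping.single 0 a"]) (simp add: eval_rpoly_single)

lemma poly_in_phi_add: "poly_in_phi g \<Longrightarrow> poly_in_phi h \<Longrightarrow> poly_in_phi (\<lambda>x. g x + h x)"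
  unfolding poly_in_phi_def by (metis eval_rpoly_add)

lemma poly_in_phi_mult: "poly_in_phi g \<Longrightarrow> poly_in_phi h \<Longrightarrow> poly_in_phi (\<lambda>x. g x * h x)"
  unfolding poly_in_phi_def by (metis eval_rpoly_mult)

lemma poly_in_phi_sum: "(\<And>a. a \<in> A \<Longrightarrow> poly_in_phi (g a)) \<Longrightarrow> poly_in_phi (\<lambda>x. \<Sum>a\<in>A. g a x)"
  by (induction A rule: infinite_finite_induct) (auto intro: poly_in_phi_const poly_in_phi_add)

lemma poly_in_phi_prod: "(\<And>a. a \<in> A \<Longrightarrow> poly_in_phi (g a)) \<Longrightarrow> poly_in_phi (\<lambda>x. \<Prod>a\<in>A. g a x)"
  by (induction A rule: infinite_finite_induct) (auto intro: poly_in_phi_const poly_in_phi_mult)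

lemma poly_in_phi_X: "poly_in_phi (X j)"
proof -
  have "(\<Prod>i\<in>UNIV. (phi x $ i) ^ Poly_Mapping.lookup (Poly_Mapping.single j 1) i) = X j x" for x
  proof -
    have "(\<Prod>i\<in>UNIV. (phi x $ i) ^ Poly_Mapping.lookup (Poly_Mapping.single j 1) i)
      = (\<Prod>i\<in>UNIV. if i = j then X i x else 1)"
      by (intro prod.cong refl) (auto simp: lookup_single phi_def)
    then show ?thesis by simp
  qed
  then show ?thesis unfolding poly_in_phi_def
    by (intro exI[of _ "Poly_Mapping.single (Poly_Mapping.single j 1) 1"]) (simp add: eval_rpoly_single)
qed

abbreviation cosvec :: "real^'n \<Rightarrow> 'n \<Rightarrow> real" where
  "cosvec x \<equiv> (\<lambda>i. cos (pi * x $ i))"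

text \<open>
  The order of the stabilizer of \<open>{..j}\<close> in the symmetric group, that is \<open>k! (n - k)!\<close> where \<open>k\<close> is
  the cardinality of \<open>{..j}\<close>.
\<close>
definition X_factor :: "'n::{finite,wellorder} \<Rightarrow> real" where
  "X_factor j = real (card {\<sigma>. \<sigma> permutes (UNIV :: 'n set) \<and> \<sigma> -` {..j} = {..j}})"

lemma X_factor_pos: "X_factor j > 0"
proof -
  have "id \<in> {\<sigma>. \<sigma> permutes (UNIV :: 'a set) \<and> \<sigma> -` {..j} = {..j}}" by (auto simp: permutes_id)
  then show ?thesis unfolding X_factor_def
    by (metis (no_types, lifting) card_gt_0_iff empty_iff finite of_nat_0_less_iff)
qed

lemma X_eq_esym: "X j x = X_factor j * esym (cosvec x) UNIV (card {..j})"
proof -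
  have "X j x = (\<Sum>\<sigma> | \<sigma> permutes UNIV. \<Prod>i\<in>\<sigma> -` {..j}. cosvec x i)"
    unfolding X_def cos_plus_def
  proof (intro sum.cong refl)
    fix \<sigma> :: "'a \<Rightarrow> 'a"
    show "(\<Prod>i\<in>UNIV. cos (pi * (\<chi> i. if i \<le> j then 1 else 0) $ \<sigma> i * x $ i)) = prod (cosvec x) (\<sigma> -` {..j})"
      by (rule prod.mono_neutral_cong_right) auto
  qed
  then show ?thesis by (simp add: sum_permutations_prod_vimage X_factor_def)
qed

text \<open>
  Every degree from \<open>1\<close> to \<open>n\<close> is that of some \<open>X\<^sub>j\<close>, although the index type is abstract.
\<close>
lemma ex_card_prefix:
  assumes "1 \<le> k" "k \<le> CARD('n::{finite,wellorder})"
  shows "\<exists>j::'n. card {..j} = k"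
proof -
  have inj: "inj (\<lambda>j::'n. card {..j})"
  proof (rule linorder_injI)
    fix i j :: 'n assume "i < j"
    then have "{..i} \<subset> {..j}" by auto
    then show "card {..i} \<noteq> card {..j}" using psubset_card_mono[of "{..j}" "{..i}"] by simp
  qed
  have "card {..j} \<in> {1..CARD('n)}" for j :: 'n
    by (auto simp: Suc_le_eq card_gt_0_iff intro!: card_mono)
  then have "range (\<lambda>j::'n. card {..j}) \<subseteq> {1..CARD('n)}" by blast
  moreover have "card (range (\<lambda>j::'n. card {..j})) = card {1..CARD('n)}"
    using inj by (simp add: card_image)
  ultimately have "range (\<lambda>j::'n. card {..j}) = {1..CARD('n)}"
    by (intro card_subset_eq) auto
  with assms have "k \<in> range (\<lambda>j::'n. card {..j})" by simp
  then show ?thesis by auto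
qed

lemma poly_in_phi_esym:
  "poly_in_phi (\<lambda>x::real^'n::{finite,wellorder}. esym (cosvec x) UNIV k)"
proof -
  consider "k = 0" | "1 \<le> k" "k \<le> CARD('n)" | "CARD('n) < k" by linarith
  then show ?thesis
  proof cases
    case 2
    then obtain j :: 'n where j: "card {..j} = k" using ex_card_prefix by blast
    have "esym (cosvec x) UNIV k = inverse (X_factor j) * X j x" for x
      using X_factor_pos[of j] by (simp add: X_eq_esym j)
    then show ?thesis by (auto intro: poly_in_phi_mult poly_in_phi_const poly_in_phi_X)
  next
    case 3
    then have "{S :: 'n set. S \<subseteq> UNIV \<and> card S = k} = {}"
      using card_mono[of "UNIV :: 'n set"] by (auto simp: not_le[symmetric])
    then have "esym (cosvec x) UNIV k = 0" for x :: "real^'n::_" by (simp add: esym_eq_sum_subsets)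
    then show ?thesis by (simp add: poly_in_phi_const)
  qed (simp add: poly_in_phi_const)
qed

text \<open>
  Newton's identity of degree \<open>k\<close> contains the \<open>k\<close>-th power sum with coefficient \<open>\<plusminus>1\<close>, and otherwise
  only elementary symmetric polynomials and lower power sums.
\<close>
lemma poly_in_phi_power_sum:
  "poly_in_phi (\<lambda>x::real^'n::{finite,wellorder}. \<Sum>j\<in>UNIV. cosvec x j ^ k)"
proof (induction k rule: less_induct)
  case (less k)
  show ?case
  proof (cases k)
    case 0
    then show ?thesis by (simp add: poly_in_phi_const)
  next
    case (Suc l)
    let ?e = "\<lambda>x::real^'n::_. esym (cosvec x) UNIV"
    let ?p = "\<lambda>(x::real^'n::_) k. \<Sum>j\<in>UNIV. cosvec x j ^ k"
    have "real (Suc l) * ?e x (Suc l) = (\<Sum>m\<le>l. (-1)^m * ?e x (l - m) * ?p x (Suc m))" for x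
    proof -
      have "real (Suc l) * ?e x (Suc l) = (\<Sum>j\<in>UNIV. \<Sum>m\<le>l. cosvec x j * ((- cosvec x j)^m * ?e x (l - m)))"
        by (simp only: esym_newton[OF finite] esym_remove_expand[OF finite UNIV_I] sum_distrib_left)
      also have "\<dots> = (\<Sum>m\<le>l. \<Sum>j\<in>UNIV. cosvec x j * ((- cosvec x j)^m * ?e x (l - m)))"
        by (rule sum.swap)
      also have "\<dots> = (\<Sum>m\<le>l. (-1)^m * ?e x (l - m) * ?p x (Suc m))"
        unfolding sum_distrib_left
        by (intro sum.cong refl) (subst power_minus, simp add: mult_ac)
      finally show ?thesis .
    qed
    moreover have "(\<Sum>m\<le>l. (-1)^m * ?e x (l - m) * ?p x (Suc m))
        = (-1)^l * ?p x (Suc l) + (\<Sum>m<l. (-1)^m * ?e x (l - m) * ?p x (Suc m))" for x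
      by (subst lessThan_Suc_atMost[symmetric]) simp
    ultimately have eq: "(-1)^l * ?p x (Suc l)
        = real (Suc l) * ?e x (Suc l) + (-1) * (\<Sum>m<l. (-1)^m * ?e x (l - m) * ?p x (Suc m))" for x
      by (simp add: algebra_simps)
    have "?p x k = (-1)^l * (real (Suc l) * ?e x (Suc l) + (-1) * (\<Sum>m<l. (-1)^m * ?e x (l - m) * ?p x (Suc m)))" for x
      unfolding eq[symmetric] Suc by (simp flip: mult.assoc power_add mult_2)
    moreover have "poly_in_phi (\<lambda>x. (-1)^l * (real (Suc l) * ?e x (Suc l) + (-1) * (\<Sum>m<l. (-1)^m * ?e x (l - m) * ?p x (Suc m))))"
      by (intro poly_in_phi_add poly_in_phi_mult poly_in_phi_const poly_in_phi_esym poly_in_phi_sum less)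
         (simp add: Suc)
    ultimately show ?thesis by (simp only:)
  qed
qed

text \<open>
  Functions of \<open>x\<close> that depend on a chosen coordinate \<open>x\<^sub>j\<close> as a polynomial in \<open>cos (\<pi> x\<^sub>j)\<close>, the
  same for all \<open>j\<close>, with coefficients that are polynomials in the \<open>X\<^sub>i\<close>. Summing such a family over
  \<open>j\<close> leaves a combination of power sums.
\<close>
inductive poly_family :: "('n::{finite,wellorder} \<Rightarrow> real^'n::_ \<Rightarrow> real) \<Rightarrow> bool" where
  power: "poly_family (\<lambda>j x. cosvec x j ^ k)"
| scale: "poly_in_phi r \<Longrightarrow> poly_family g \<Longrightarrow> poly_family (\<lambda>j x. r x * g j x)"
| add: "poly_family g \<Longrightarrow> poly_family h \<Longrightarrow> poly_family (\<lambda>j x. g j x + h j x)"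

lemma poly_in_phi_sum_family: "poly_family g \<Longrightarrow> poly_in_phi (\<lambda>x. \<Sum>j\<in>UNIV. g j x)"
proof (induction rule: poly_family.induct)
  case (scale r g)
  then show ?case by (simp flip: sum_distrib_left add: poly_in_phi_mult)
qed (auto simp: sum.distrib intro: poly_in_phi_power_sum poly_in_phi_add)

lemma poly_family_mult:
  assumes "poly_family g" "poly_family h"
  shows "poly_family (\<lambda>j x. g j x * h j x)"
  using assms(1)
proof (induction rule: poly_family.induct)
  case (power k)
  show ?case using assms(2)
  proof (induction rule: poly_family.induct)
    case (power l)
    then show ?case using poly_family.power[of "k + l"] by (simp add: power_add)
  next
    case (scale r g)
    then show ?case using poly_family.scale[of r "\<lambda>j x. cosvec x j ^ k * g j x"] by (simp add: mult_ac)
  next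
    case (add g h)
    then show ?case using poly_family.add[OF add.IH] by (simp add: distrib_left)
  qed
next
  case (scale r g)
  then show ?case using poly_family.scale[OF scale.hyps(1) scale.IH] by (simp add: mult.assoc)
next
  case (add g1 g2)
  then show ?case using poly_family.add[OF add.IH] by (simp add: distrib_right)
qed

lemma poly_family_coeff: "poly_in_phi r \<Longrightarrow> poly_family (\<lambda>j x. r x)"
  using poly_family.scale[OF _ poly_family.power[of 0]] by simp

lemma poly_family_sum:
  "(\<And>a. a \<in> A \<Longrightarrow> poly_family (g a)) \<Longrightarrow> poly_family (\<lambda>j x. \<Sum>a\<in>A. g a j x)"
  by (induction A rule: infinite_finite_induct)
     (auto intro: poly_family.add poly_family_coeff poly_in_phi_const)

text \<open>
  Chebyshev polynomials: \<open>cos ((m + 2)t) = 2 cos t cos ((m + 1)t) - cos (mt)\<close>.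
\<close>
lemma poly_family_cos_multiple:
  "poly_family (\<lambda>j (x::real^'n::{finite,wellorder}). cos (real_of_int k * (pi * x $ j)))"
proof -
  have nat: "poly_family (\<lambda>j (x::real^'n::_). cos (real m * (pi * x $ j)))" for m
  proof (induction m rule: induct_nat_012)
    case 0
    then show ?case using poly_family.power[of 0] by simp
  next
    case 1
    then show ?case using poly_family.power[of 1] by simp
  next
    case (ge2 m)
    have "cos (real (Suc (Suc m)) * t) = 2 * (cos t ^ 1 * cos (real (Suc m) * t)) + (-1) * cos (real m * t)" for t
      using cos_add[of "real (Suc m) * t" t] cos_diff[of "real (Suc m) * t" t] by (simp add: algebra_simps)
    then show ?case
      by (simp only:) (intro poly_family.add poly_family.scale poly_family_mult poly_in_phi_const
          poly_family.power ge2)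
  qed
  have "cos (real_of_int k * t) = cos (real (nat \<bar>k\<bar>) * t)" for t
  proof (cases "k \<ge> 0")
    case False
    then have "real (nat \<bar>k\<bar>) * t = - (real_of_int k * t)" by simp
    then show ?thesis by (simp only: cos_minus)
  qed simp
  then show ?thesis using nat[of "nat \<bar>k\<bar>"] by (simp only:)
qed

text \<open>
  The rows of \<open>A\<close> are indexed by the coordinates, and \<open>(det A)\<^sup>2 = det (A\<^sup>T A)\<close> has entries that are
  sums over the coordinates.
\<close>
lemma poly_in_phi_det_squared:
  fixes A :: "real^'n::{finite,wellorder} \<Rightarrow> real^'n::_^'n::_"
  assumes "\<And>j k. poly_family (\<lambda>i x. A x $ i $ j * A x $ i $ k)"
  shows "poly_in_phi (\<lambda>x. (det (A x))\<^sup>2)"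
proof -
  have "(det (A x))\<^sup>2 = det (transpose (A x) ** A x)" for x
    by (simp add: det_mul det_transpose power2_eq_square)
  also have "\<dots> x = (\<Sum>p | p permutes UNIV. of_int (sign p) * (\<Prod>j\<in>UNIV. \<Sum>i\<in>UNIV. A x $ i $ j * A x $ i $ p j))" for x
    by (simp add: det_def matrix_matrix_mult_def transpose_def)
  finally show ?thesis
    by (auto intro!: poly_in_phi_sum poly_in_phi_mult poly_in_phi_prod poly_in_phi_const
        poly_in_phi_sum_family assms)
qed

lemma cos_minus_eq_det: "cos_minus l x = det (\<chi> i j. cos (pi * l $ j * x $ i))"
  by (simp add: cos_minus_def det_def)

section \<open>The Jacobian determinant\<close>

definition dphi :: "real^'n::{finite,wellorder} \<Rightarrow> real^'n::_^'n::_" where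
  "dphi x = (\<chi> i j. X_factor i * ((- pi * sin (pi * x $ j)) * esym (cosvec x) (UNIV - {j}) (card {..<i})))"

lemma card_atMost_eq_Suc: "card {..i} = Suc (card {..<(i::'n::{finite,wellorder})})"
proof -
  have "{..i} = insert i {..<i}" by auto
  then show ?thesis by simp
qed

lemma phi_has_derivative: "(phi has_derivative (*v) (dphi x)) (at x)"
  unfolding has_derivative_componentwise_within[of phi]
proof (rule ballI)
  fix b :: "real^'a::_" assume "b \<in> Basis"
  then obtain i where b: "b = axis i 1" by (auto simp: Basis_vec_def)
  have "((\<lambda>x. esym (cosvec x) UNIV (Suc (card {..<i}))) has_derivative
     (\<lambda>h. \<Sum>j\<in>UNIV. (- pi * sin (pi * x $ j)) * esym (cosvec x) (UNIV - {j}) (card {..<i}) * h $ j)) (at x)"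
    by (rule esym_has_derivative) (auto intro!: derivative_eq_intros bounded_linear_imp_has_derivative
          bounded_linear_vec_nth simp: mult_ac)
  from has_derivative_mult_right[OF this, of "X_factor i"]
  have "(X i has_derivative (\<lambda>h. (dphi x *v h) $ i)) (at x)"
    by (simp add: X_eq_esym[abs_def] card_atMost_eq_Suc matrix_vector_mult_def dphi_def sum_distrib_left mult_ac)
  then show "((\<lambda>x. phi x \<bullet> b) has_derivative (\<lambda>h. (dphi x *v h) \<bullet> b)) (at x)"
    by (simp add: b inner_axis phi_def)
qed

lemma J_eq_det: "J x = det (dphi x)"
  unfolding J_def jacobian_def frechet_derivative_at[OF phi_has_derivative[of x], symmetric]
  by (rule arg_cong[OF matrix_of_matrix_vector_mul])

lemma poly_family_esym_remove:
  "poly_family (\<lambda>j (x::real^'n::{finite,wellorder}). esym (cosvec x) (UNIV - {j}) k)"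
proof -
  have "esym (cosvec x) (UNIV - {j}) k = (\<Sum>m\<le>k. ((-1)^m * esym (cosvec x) UNIV (k - m)) * cosvec x j ^ m)"
    for x :: "real^'n::_" and j
    unfolding esym_remove_expand[OF finite UNIV_I]
    by (intro sum.cong refl) (subst power_minus, simp add: mult_ac)
  then show ?thesis
    by (auto intro!: poly_family_sum poly_family.scale poly_family.power poly_in_phi_mult
        poly_in_phi_const poly_in_phi_esym)
qed

text \<open>
  The derivative in the direction of \<open>x\<^sub>j\<close> has the factor \<open>sin (\<pi> x\<^sub>j)\<close>. In a Gram entry this factor
  occurs squared, hence as \<open>1 - c\<^sub>j\<^sup>2\<close>.
\<close>
lemma poly_in_phi_J_squared: "poly_in_phi (\<lambda>x::real^'n::{finite,wellorder}. (J x)\<^sup>2)"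
proof -
  have "(J x)\<^sup>2 = (det (transpose (dphi x)))\<^sup>2" for x :: "real^'n::_"
    by (simp add: J_eq_det det_transpose)
  moreover have "poly_in_phi (\<lambda>x::real^'n::_. (det (transpose (dphi x)))\<^sup>2)"
  proof (rule poly_in_phi_det_squared)
    fix i k :: 'n
    let ?e = "\<lambda>l j (x::real^'n::_). esym (cosvec x) (UNIV - {j}) (card {..<(l::'n)})"
    have "transpose (dphi x) $ j $ i * transpose (dphi x) $ j $ k
       = (X_factor i * X_factor k * pi\<^sup>2) * ((1 + (-1) * cosvec x j ^ 2) * (?e i j x * ?e k j x))" for j and x :: "real^'n::_"
    proof -
      have "1 + (-1) * cosvec x j ^ 2 = sin (pi * x $ j) * sin (pi * x $ j)"
        using sin_squared_eq[of "pi * x $ j"] by (simp add: power2_eq_square)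
      then show ?thesis by (simp only: transpose_def dphi_def vec_lambda_beta) (simp add: power2_eq_square mult_ac)
    qed
    then show "poly_family (\<lambda>j x. transpose (dphi x) $ j $ i * transpose (dphi x) $ j $ k)"
      by (simp only:) (intro poly_family.scale poly_family_mult poly_family.add poly_family_coeff
          poly_in_phi_const poly_family.power poly_family_esym_remove)
  qed
  ultimately show ?thesis by simp
qed

section \<open>Injectivity, uniqueness of the polynomials, and regular points\<close>

text \<open>
  Vanishing moments give \<open>\<Sum> w\<^sub>j q(c\<^sub>j) = 0\<close> for every polynomial \<open>q\<close>; choose \<open>q\<close> to vanish at all
  values of \<open>c\<close> except \<open>a\<close>. This serves both the injectivity of \<^const>\<open>phi\<close>, where the weights are
  \<open>1\<close> and \<open>-1\<close>, and the regularity of its derivative, where they are the entries of a kernel vector.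
\<close>
lemma level_sums_eq_0:
  fixes c w :: "'a \<Rightarrow> real"
  assumes "finite A" and moments: "\<And>k. (\<Sum>j\<in>A. w j * c j ^ k) = 0"
  shows "(\<Sum>j | j \<in> A \<and> c j = a. w j) = 0"
proof -
  define q where "q = (\<Prod>v\<in>c ` A - {a}. [:- v, 1:])"
  have q: "poly q a \<noteq> 0" "\<And>b. b \<in> c ` A - {a} \<Longrightarrow> poly q b = 0"
    using assms(1) by (auto simp: q_def poly_prod)
  have "0 = (\<Sum>i\<le>degree q. coeff q i * (\<Sum>j\<in>A. w j * c j ^ i))"
    by (simp add: moments)
  also have "\<dots> = (\<Sum>j\<in>A. w j * poly q (c j))"
    unfolding sum_distrib_left poly_altdef by (subst sum.swap) (simp add: mult_ac)
  also have "\<dots> = (\<Sum>j | j \<in> A \<and> c j = a. w j * poly q (c j))"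
    using assms(1) q(2) by (intro sum.mono_neutral_right) auto
  also have "\<dots> = (\<Sum>j | j \<in> A \<and> c j = a. w j) * poly q a"
    unfolding sum_distrib_right by (intro sum.cong) auto
  finally show ?thesis using q(1) by simp
qed

text \<open>
  A decreasing sequence is determined by how often it takes each value: the sets
  \<open>{j. a \<le> x\<^sub>j}\<close> are initial segments of the index type, so their cardinality determines them.
\<close>
lemma F_eqI:
  fixes x y :: "real^'n::{finite,wellorder}"
  assumes "x \<in> F" "y \<in> F" and counts: "\<And>a. card {j. x $ j = a} = card {j. y $ j = a}"
  shows "x = y"
proof -
  have count_ge: "card {j. z $ j \<ge> a} = (\<Sum>b | b \<in> range (($) x) \<union> range (($) y) \<and> b \<ge> a. card {j. z $ j = b})"
    if "z = x \<or> z = y" for z a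
  proof -
    have "{j. z $ j \<ge> a} = (\<Union>b\<in>{b \<in> range (($) x) \<union> range (($) y). b \<ge> a}. {j. z $ j = b})"
      using that by auto
    then show ?thesis by (simp only:) (subst card_UN_disjoint, auto)
  qed
  have eq: "{j. x $ j \<ge> a} = {j. y $ j \<ge> a}" for a
  proof -
    have down: "i \<in> {j. z $ j \<ge> a}" if "j \<in> {j. z $ j \<ge> a}" "i \<le> j" "z \<in> F" for i j and z :: "real^'n::_"
    proof -
      have "z $ j \<le> z $ i" using that(2,3) by (simp add: F_def)
      with that(1) show ?thesis by simp
    qed
    have card: "card {j. x $ j \<ge> a} = card {j. y $ j \<ge> a}"
      using count_ge[of x a] count_ge[of y a] counts by simp
    have "{j. x $ j \<ge> a} \<subseteq> {j. y $ j \<ge> a} \<or> {j. y $ j \<ge> a} \<subseteq> {j. x $ j \<ge> a}"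
    proof (rule ccontr)
      assume "\<not> ?thesis"
      then obtain i j where "i \<in> {j. x $ j \<ge> a}" "i \<notin> {j. y $ j \<ge> a}"
        "j \<in> {j. y $ j \<ge> a}" "j \<notin> {j. x $ j \<ge> a}" by blast
      moreover have "i \<le> j \<or> j \<le> i" by (rule linear)
      ultimately show False using down assms(1,2) by metis
    qed
    then show ?thesis using card card_subset_eq[of "{j. y $ j \<ge> a}" "{j. x $ j \<ge> a}"]
        card_subset_eq[of "{j. x $ j \<ge> a}" "{j. y $ j \<ge> a}"] by auto
  qed
  have "x $ i = y $ i" for i
  proof (rule antisym)
    have "i \<in> {j. y $ j \<ge> x $ i}" unfolding eq[symmetric] by simp
    then show "x $ i \<le> y $ i" by simp
    have "i \<in> {j. x $ j \<ge> y $ i}" unfolding eq by simp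
    then show "y $ i \<le> x $ i" by simp
  qed
  then show ?thesis by (simp add: vec_eq_iff)
qed

text \<open>
  The power sums are polynomials in \<open>\<phi>(x)\<close>, so equal images have equal power sums, and then each
  cosine occurs equally often on both sides; the cosine is injective on \<open>[0,\<pi>]\<close>.
\<close>
lemma inj_on_phi: "inj_on phi (F :: (real^'n::{finite,wellorder}) set)"
proof (rule inj_onI)
  fix x y :: "real^'n::_" assume xy: "x \<in> F" "y \<in> F" and eq: "phi x = phi y"
  let ?c = "case_sum (cosvec x) (cosvec y)" and ?w = "case_sum (\<lambda>_. 1) (\<lambda>_. -1) :: 'n + 'n \<Rightarrow> real"
  have "(\<Sum>j\<in>UNIV. cosvec x j ^ k) = (\<Sum>j\<in>UNIV. cosvec y j ^ k)" for k
    using poly_in_phi_power_sum[of k] eq unfolding poly_in_phi_def by metis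
  then have "(\<Sum>j\<in>UNIV <+> UNIV. ?w j * ?c j ^ k) = 0" for k
    unfolding sum.Plus[OF finite finite] by (simp add: sum_negf)
  then have level: "(\<Sum>j | j \<in> UNIV <+> UNIV \<and> ?c j = a. ?w j) = 0" for a
    by (intro level_sums_eq_0) auto
  have cos_counts: "card {j. cosvec x j = a} = card {j. cosvec y j = a}" for a
  proof -
    have "{j. j \<in> UNIV <+> UNIV \<and> ?c j = a} = {j. cosvec x j = a} <+> {j. cosvec y j = a}"
      (is "?L = ?R")
    proof (rule set_eqI)
      fix z show "z \<in> ?L \<longleftrightarrow> z \<in> ?R" by (cases z) auto
    qed
    then have "(\<Sum>j\<in>{j. cosvec x j = a} <+> {j. cosvec y j = a}. ?w j) = 0"
      using level[of a] by (simp only:)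
    then have "real (card {j. cosvec x j = a}) - real (card {j. cosvec y j = a}) = 0"
      unfolding sum.Plus[OF finite finite] by simp
    then show ?thesis by simp
  qed
  have "card {j. x $ j = a} = card {j. y $ j = a}" for a
  proof (cases "0 \<le> a \<and> a \<le> 1")
    case True
    have "z $ j = a \<longleftrightarrow> cosvec z j = cos (pi * a)" if "z \<in> F" for z :: "real^'n::_" and j
    proof -
      have "0 \<le> z $ j" "z $ j \<le> 1" using that by (auto simp: F_def)
      then show ?thesis using True cos_inj_pi[of "pi * z $ j" "pi * a"] by auto
    qed
    then show ?thesis using cos_counts xy by simp
  next
    case False
    then have "{j. x $ j = a} = {}" "{j. y $ j = a} = {}" using xy by (auto simp: F_def)
    then show ?thesis by simp
  qed
  then show "x = y" using xy by (intro F_eqI) auto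
qed

definition F_strict :: "(real^'n::{finite,wellorder}) set" where
  "F_strict = {x. (\<forall>i. 0 < x $ i \<and> x $ i < 1) \<and> (\<forall>i j. i < j \<longrightarrow> x $ j < x $ i)}"

lemma F_strict_subset: "F_strict \<subseteq> F"
  by (auto simp: F_strict_def F_def le_less)

lemma open_F_strict: "open F_strict"
proof -
  have "F_strict = (\<Inter>i. {x. 0 < x $ i}) \<inter> (\<Inter>i. {x. x $ i < 1}) \<inter>
      (\<Inter>p\<in>{p. fst p < snd p}. {x :: real^'a::{finite,wellorder}. x $ snd p < x $ fst p})"
    by (auto simp: F_strict_def)
  moreover have "open \<dots>"
    by (intro open_Int open_INT finite ballI open_Collect_less continuous_intros)
  ultimately show ?thesis by simp
qed

lemma F_strict_nonempty: "F_strict \<noteq> {}"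
proof -
  let ?d = "\<lambda>i::'a. real (card {j. i < j})"
  have "?d j < ?d i" if "i < j" for i j
    using that by (auto intro!: psubset_card_mono)
  moreover have "?d i < real CARD('a)" for i
    by (auto intro!: psubset_card_mono)
  ultimately have "(\<chi> i. (?d i + 1) / (real CARD('a) + 1)) \<in> F_strict"
    by (auto simp: F_strict_def divide_strict_right_mono)
  then show ?thesis by blast
qed

text \<open>
  Induction on the set of variables: a polynomial in the variable \<open>k\<close> with infinitely many zeros
  vanishes, so the induction hypothesis applies to the terms with a fixed exponent of \<open>k\<close>. The terms
  are indexed by an abstract set \<open>T\<close>, and only their exponents on \<open>I\<close> have to be distinct.
\<close>
lemma monomials_independent:
  fixes e :: "'t \<Rightarrow> 'i \<Rightarrow> nat" and a :: "'t \<Rightarrow> real" and S :: "'i \<Rightarrow> real set"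
  assumes "finite I" "finite T"
    and "\<And>s t. s \<in> T \<Longrightarrow> t \<in> T \<Longrightarrow> (\<And>i. i \<in> I \<Longrightarrow> e s i = e t i) \<Longrightarrow> s = t"
    and "\<And>i. i \<in> I \<Longrightarrow> infinite (S i)"
    and "\<And>y. (\<And>i. i \<in> I \<Longrightarrow> y i \<in> S i) \<Longrightarrow> (\<Sum>t\<in>T. a t * (\<Prod>i\<in>I. y i ^ e t i)) = 0"
    and "t \<in> T"
  shows "a t = 0"
  using assms
proof (induction I arbitrary: T rule: finite_induct)
  case empty
  then have "T = {t}" by blast
  then show ?case using empty.prems(4) by simp
next
  case (insert k I)
  let ?T = "{s \<in> T. e s k = e t k}"
  show ?case
  proof (rule insert.IH[of ?T])
    fix y :: "'i \<Rightarrow> real" assume y: "\<And>i. i \<in> I \<Longrightarrow> y i \<in> S i"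
    define q where "q = (\<Sum>s\<in>T. monom (a s * (\<Prod>i\<in>I. y i ^ e s i)) (e s k))"
    have "poly q z = 0" if z: "z \<in> S k" for z
    proof -
      have "(y(k := z)) i \<in> S i" if "i \<in> insert k I" for i using that y z by auto
      then have "(\<Sum>s\<in>T. a s * (\<Prod>i\<in>insert k I. (y(k := z)) i ^ e s i)) = 0"
        using insert.prems(4) by blast
      moreover have "(\<Prod>i\<in>I. (y(k := z)) i ^ e s i) = (\<Prod>i\<in>I. y i ^ e s i)" for s
        using insert.hyps by (intro prod.cong) auto
      ultimately show ?thesis
        using insert.hyps by (simp add: q_def poly_sum poly_monom mult_ac)
    qed
    then have "S k \<subseteq> {z. poly q z = 0}" by blast
    then have "q = 0" using insert.prems(3)[of k] poly_roots_finite[of q] finite_subset by blast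
    then have "coeff q (e t k) = 0" by simp
    then show "(\<Sum>s\<in>?T. a s * (\<Prod>i\<in>I. y i ^ e s i)) = 0"
      using insert.prems(1) by (simp add: q_def coeff_sum sum.inter_filter)
  next
    fix s s' assume s: "s \<in> ?T" "s' \<in> ?T" and eq: "\<And>i. i \<in> I \<Longrightarrow> e s i = e s' i"
    have "e s i = e s' i" if "i \<in> insert k I" for i
      using that s eq by auto
    with s show "s = s'" using insert.prems(2)[of s s'] by blast
  qed (use insert.prems in auto)
qed

text \<open>
  By invariance of domain the image of the interior of \<^const>\<open>F\<close> is open, so it contains a product of
  infinite sets, on which monomials are independent.
\<close>
lemma rpoly_eqI_phi:
  fixes p q :: "'n::{finite,wellorder} rpoly"
  assumes eq: "\<And>x. x \<in> F \<Longrightarrow> eval_rpoly p (phi x) = eval_rpoly q (phi x)"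
  shows "p = q"
proof -
  have "continuous_on F_strict (phi :: real^'n::_ \<Rightarrow> _)"
    using phi_has_derivative by (meson has_derivative_at_withinI has_derivative_continuous_on)
  then have "open (phi ` F_strict :: (real^'n::_) set)"
    using inj_on_subset[OF inj_on_phi F_strict_subset] by (intro invariance_of_domain open_F_strict)
  moreover obtain Y :: "real^'n::_" where "Y \<in> phi ` F_strict" using F_strict_nonempty by blast
  ultimately obtain A where A: "\<And>i. open (A i)" "\<And>i. Y $ i \<in> A i"
    and sub: "\<And>Z. (\<And>i. Z $ i \<in> A i) \<Longrightarrow> Z \<in> phi ` F_strict"
    unfolding open_vec_def by metis
  let ?K = "Poly_Mapping.keys p \<union> Poly_Mapping.keys q"
  have diff: "Poly_Mapping.lookup p m - Poly_Mapping.lookup q m = 0" if m: "m \<in> ?K" for m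
  proof (rule monomials_independent[where I = UNIV and T = ?K and S = A and e = Poly_Mapping.lookup])
    fix y assume y: "\<And>i. i \<in> UNIV \<Longrightarrow> y i \<in> A i"
    let ?Z = "(\<chi> i. y i) :: real^'n::_"
    have "?Z \<in> phi ` F_strict" using y by (intro sub) simp
    then obtain x where "x \<in> F" "?Z = phi x" using F_strict_subset by (auto simp: subset_iff)
    then have "eval_rpoly p ?Z = eval_rpoly q ?Z" using eq[of x] by simp
    then show "(\<Sum>m\<in>?K. (Poly_Mapping.lookup p m - Poly_Mapping.lookup q m) * (\<Prod>i\<in>UNIV. y i ^ Poly_Mapping.lookup m i)) = 0"
      by (simp add: eval_rpoly_superset[of ?K] left_diff_distrib sum_subtractf)
  next
    show "infinite (A i)" for i
      using A[of i] finite_imp_not_open[of "A i"] by blast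
  qed (use m in \<open>auto intro: poly_mapping_eqI\<close>)
  show ?thesis
  proof (rule poly_mapping_eqI)
    fix m show "Poly_Mapping.lookup p m = Poly_Mapping.lookup q m"
      using diff[of m] by (cases "m \<in> ?K") (auto simp: in_keys_iff)
  qed
qed

lemma eval_poly_via_phi:
  assumes "poly_in_phi g" "x \<in> F"
  shows "eval_rpoly (poly_via_phi g) (phi x) = g x"
proof -
  obtain p where p: "\<And>x. eval_rpoly p (phi x) = g x" using assms(1) by (auto simp: poly_in_phi_def)
  have "poly_via_phi g = p"
    unfolding poly_via_phi_def by (rule the_equality) (auto simp: p intro: rpoly_eqI_phi)
  then show ?thesis by (simp add: p)
qed

lemma JJ_phi: "x \<in> F \<Longrightarrow> JJ (phi x) = \<bar>J x\<bar>"
  by (simp add: JJ_def p_I_plus_def eval_poly_via_phi poly_in_phi_J_squared)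

text \<open>
  For a vector \<open>v\<close> in the kernel put \<open>w\<^sub>j = sin (\<pi> x\<^sub>j) v\<^sub>j\<close>. The kernel equations involve elementary
  symmetric polynomials without the index \<open>j\<close>. Expanding these in powers of \<open>c\<^sub>j\<close> gives a triangular
  system, which says that all moments \<open>\<Sum> w\<^sub>j c\<^sub>j\<^sup>k\<close> vanish. The \<open>c\<^sub>j\<close> are distinct, so \<open>w = 0\<close>, and the
  sines are positive.
\<close>
lemma J_nonzero:
  fixes x :: "real^'n::{finite,wellorder}"
  assumes "x \<in> F_strict"
  shows "J x \<noteq> 0"
proof -
  have x01: "0 < x $ i" "x $ i < 1" for i using assms by (auto simp: F_strict_def)
  have "inj (($) x)"
  proof (rule linorder_injI)
    fix i j :: 'n assume "i < j"
    then have "x $ j < x $ i" using assms by (simp add: F_strict_def)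
    then show "x $ i \<noteq> x $ j" by simp
  qed
  then have inj: "cosvec x i = cosvec x j \<longleftrightarrow> i = j" for i j
    using x01[of i] x01[of j] cos_inj_pi[of "pi * x $ i" "pi * x $ j"] by (auto dest: injD)
  have "v = 0" if v: "dphi x *v v = 0" for v
  proof -
    let ?w = "\<lambda>j. sin (pi * x $ j) * v $ j"
    have weighted: "(\<Sum>j\<in>UNIV. ?w j * esym (cosvec x) (UNIV - {j}) k) = 0" for k
    proof (cases "k < CARD('n)")
      case True
      then obtain i :: 'n where "card {..i} = Suc k" using ex_card_prefix[of "Suc k", where 'n = 'n] by auto
      then have i: "card {..<i} = k" by (simp add: card_atMost_eq_Suc)
      have "(- pi * X_factor i) * (\<Sum>j\<in>UNIV. ?w j * esym (cosvec x) (UNIV - {j}) k) = (dphi x *v v) $ i"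
        by (simp add: matrix_vector_mult_def dphi_def i sum_distrib_left mult_ac)
      then show ?thesis using v X_factor_pos[of i] by simp
    next
      case False
      have "{S. S \<subseteq> UNIV - {j} \<and> card S = k} = {}" for j :: 'n
      proof -
        have "card S \<noteq> k" if "S \<subseteq> UNIV - {j}" for S
        proof -
          have "S \<subset> UNIV" using that by auto
          then have "card S < CARD('n)" by (intro psubset_card_mono) auto
          with False show ?thesis by simp
        qed
        then show ?thesis by (simp only: Collect_empty_eq) metis
      qed
      then have "esym (cosvec x) (UNIV - {j}) k = 0" for j
        by (simp only: esym_eq_sum_subsets[OF finite] sum.empty)
      then show ?thesis by simp
    qed
    have moments: "(\<Sum>j\<in>UNIV. ?w j * cosvec x j ^ k) = 0" for k
    proof (induction k rule: less_induct)
      case (less k)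
      let ?e = "\<lambda>m. esym (cosvec x) UNIV (k - m)"
      have "0 = (\<Sum>j\<in>UNIV. ?w j * (\<Sum>m\<le>k. (- cosvec x j) ^ m * ?e m))"
        using weighted[of k] by (simp add: esym_remove_expand)
      also have "\<dots> = (\<Sum>m\<le>k. (-1)^m * ?e m * (\<Sum>j\<in>UNIV. ?w j * cosvec x j ^ m))"
        unfolding sum_distrib_left
        by (subst sum.swap, intro sum.cong refl) (subst power_minus, simp add: mult_ac)
      also have "\<dots> = (-1)^k * (\<Sum>j\<in>UNIV. ?w j * cosvec x j ^ k)
          + (\<Sum>m<k. (-1)^m * ?e m * (\<Sum>j\<in>UNIV. ?w j * cosvec x j ^ m))"
        by (subst lessThan_Suc_atMost[symmetric]) simp
      also have "(\<Sum>m<k. (-1)^m * ?e m * (\<Sum>j\<in>UNIV. ?w j * cosvec x j ^ m)) = 0"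
        using less by (intro sum.neutral) simp
      finally show ?case by simp
    qed
    have "v $ i = 0" for i
    proof -
      have "(\<Sum>j | j \<in> UNIV \<and> cosvec x j = cosvec x i. ?w j) = 0"
        by (rule level_sums_eq_0[OF finite moments])
      then have "?w i = 0" by (simp add: inj)
      moreover have "sin (pi * x $ i) > 0" using x01[of i] by (intro sin_gt_zero) auto
      ultimately show ?thesis by simp
    qed
    then show ?thesis by (simp add: vec_eq_iff)
  qed
  then have "invertible (dphi x)"
    by (metis invertible_left_inverse matrix_left_invertible_ker)
  then show ?thesis by (simp add: J_eq_det invertible_det_nz)
qed

section \<open>Change of variables\<close>

text \<open>
  A point of \<^const>\<open>F\<close> outside \<^const>\<open>F_strict\<close> lies on one of the finitely many hyperplanes
  \<open>x\<^sub>i = 0\<close>, \<open>x\<^sub>i = 1\<close> or \<open>x\<^sub>i = x\<^sub>j\<close>.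
\<close>
lemma negligible_F_minus_F_strict: "negligible (F - F_strict :: (real^'n::{finite,wellorder}) set)"
proof -
  let ?A = "\<lambda>i c. {x :: real^'n::_. axis i 1 \<bullet> x = (c::real)}"
  let ?B = "\<lambda>(i,j). {x :: real^'n::_. (axis i 1 - axis j 1) \<bullet> x = 0}"
  have "negligible (?A i c)" for i c
    by (rule negligible_hyperplane) (simp add: axis_eq_0_iff)
  moreover have "negligible (?B p)" if "p \<in> {p. fst p < snd p}" for p
  proof -
    obtain i j where p: "p = (i, j)" "i < j" using \<open>p \<in> _\<close> by (cases p) auto
    then have "axis i (1::real) \<noteq> axis j 1" by (auto simp: axis_eq_axis)
    then show ?thesis unfolding p by (auto intro!: negligible_hyperplane)
  qed
  ultimately have "negligible ((\<Union>i. ?A i 0) \<union> (\<Union>i. ?A i 1) \<union> (\<Union>p\<in>{p. fst p < snd p}. ?B p))"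
    by (intro negligible_Un negligible_Union finite_imageI finite) auto
  moreover have "F - F_strict \<subseteq> (\<Union>i. ?A i 0) \<union> (\<Union>i. ?A i 1) \<union> (\<Union>p\<in>{p. fst p < snd p}. ?B p)"
  proof
    fix x :: "real^'n::_" assume x: "x \<in> F - F_strict"
    then consider i where "\<not> (0 < x $ i \<and> x $ i < 1)" | i j where "i < j" "\<not> x $ j < x $ i"
      by (auto simp: F_strict_def)
    then show "x \<in> (\<Union>i. ?A i 0) \<union> (\<Union>i. ?A i 1) \<union> (\<Union>p\<in>{p. fst p < snd p}. ?B p)"
    proof cases
      case 1
      moreover have "0 \<le> x $ i" "x $ i \<le> 1" using x by (auto simp: F_def)
      ultimately have "x $ i = 0 \<or> x $ i = 1" by linarith
      then show ?thesis by (auto simp: inner_axis')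
    next
      case 2
      moreover have "x $ j \<le> x $ i" using x 2(1) by (auto simp: F_def)
      ultimately have "x \<in> ?B (i, j)" by (simp add: inner_axis' inner_diff_left)
      with 2(1) show ?thesis by force
    qed
  qed
  ultimately show ?thesis by (rule negligible_subset)
qed

lemma F_subset_cube: "F \<subseteq> cbox 0 (1 :: real^'n::{finite,wellorder})"
  by (auto simp: F_def mem_box_cart)

lemma closed_F: "closed (F :: (real^'n::{finite,wellorder}) set)"
proof -
  have "F = (\<Inter>i. {x. 0 \<le> x $ i}) \<inter> (\<Inter>i. {x. x $ i \<le> 1}) \<inter>
      (\<Inter>p\<in>{p. fst p \<le> snd p}. {x :: real^'n::_. x $ snd p \<le> x $ fst p})"
    by (auto simp: F_def)
  moreover have "closed \<dots>"
    by (intro closed_Int closed_INT ballI closed_Collect_le continuous_intros)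
  ultimately show ?thesis by simp
qed

lemma F_lebesgue: "F \<in> sets lebesgue"
  by (intro sets_completionI_sets) (simp add: borel_closed[OF closed_F])

lemma absolutely_integrable_on_F:
  assumes "continuous_on UNIV (w :: real^'n::{finite,wellorder} \<Rightarrow> real)"
  shows "w absolutely_integrable_on F"
  using assms
  by (intro set_integrable_subset[OF absolutely_integrable_continuous F_lebesgue F_subset_cube])
     (auto intro: continuous_on_subset)

text \<open>
  The hypothesis asks for the transformed integrand to agree with the continuous function \<open>w\<close> only
  where \<open>J\<close> does not vanish. This matters because quotients by \<open>JJ\<close> are \<open>0\<close> elsewhere.
\<close>
lemma integral_FF:
  fixes w G :: "real^'n::{finite,wellorder} \<Rightarrow> real"
  assumes cont: "continuous_on UNIV w"
    and eq: "\<And>x. x \<in> F \<Longrightarrow> J x \<noteq> 0 \<Longrightarrow> \<bar>J x\<bar> * G (phi x) = w x"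
  shows "set_integrable lebesgue FF G \<and> (LINT Y:FF|lebesgue. G Y) = integral F w"
proof -
  let ?h = "\<lambda>x. \<bar>J x\<bar> * G (phi x)"
  have h: "?h x = w x" if "x \<in> F - (F - F_strict)" for x
    using that by (intro eq J_nonzero) auto
  have "?h absolutely_integrable_on F"
    by (rule absolutely_integrable_spike[OF absolutely_integrable_on_F[OF cont] negligible_F_minus_F_strict h])
  moreover have "integral F ?h = integral F w"
    by (rule integral_spike[OF negligible_F_minus_F_strict]) (use h in auto)
  moreover have "(\<lambda>x. \<bar>det (matrix ((*v) (dphi x)))\<bar> *\<^sub>R (vec (G (phi x)) :: real^1)) absolutely_integrable_on F \<and>
         integral F (\<lambda>x. \<bar>det (matrix ((*v) (dphi x)))\<bar> *\<^sub>R vec (G (phi x))) = (vec (integral F w) :: real^1)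
     \<longleftrightarrow> (\<lambda>x. vec (G x) :: real^1) absolutely_integrable_on (phi ` F) \<and>
         integral (phi ` F) (\<lambda>x. vec (G x)) = (vec (integral F w) :: real^1)"
    by (rule has_absolute_integral_change_of_variables[OF F_lebesgue
          has_derivative_at_withinI[OF phi_has_derivative] inj_on_phi])
  moreover have "matrix ((*v) (dphi x)) = dphi x" for x :: "real^'n::_"
    by (rule matrix_of_matrix_vector_mul)
  ultimately have "G absolutely_integrable_on FF \<and> integral FF G = integral F w"
    by (simp add: absolutely_integrable_on_1_iff integral_on_1_eq J_eq_det FF_def)
  then show ?thesis by (simp add: set_lebesgue_integral_eq_integral(2))
qed

section \<open>Symmetrization\<close>

abbreviation permute_coords :: "('n \<Rightarrow> 'n) \<Rightarrow> 'a^'n \<Rightarrow> 'a^'n" where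
  "permute_coords \<sigma> x \<equiv> (\<chi> i. x $ \<sigma> i)"

text \<open>
  Rearrangement inequality: a permutation that maximizes \<open>\<Sum> d\<^sub>i x\<^sub>\<sigma>\<^sub>(\<^sub>i\<^sub>)\<close> for decreasing \<open>d\<close> sorts \<open>x\<close>,
  because exchanging two entries in the wrong order would increase the sum.
\<close>
lemma ex_sorting_permutation:
  fixes x :: "real^'n::{finite,wellorder}"
  assumes "x \<in> cbox 0 1"
  shows "\<exists>\<sigma>. \<sigma> permutes UNIV \<and> permute_coords \<sigma> x \<in> F"
proof -
  define d where "d i = real (card {j::'n. i < j})" for i
  have d: "d j < d i" if "i < j" for i j
    using that by (auto simp: d_def intro!: psubset_card_mono)
  define s where "s \<sigma> = (\<Sum>i\<in>UNIV. d i * x $ \<sigma> i)" for \<sigma>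
  let ?P = "{\<sigma>. \<sigma> permutes (UNIV :: 'n set)}"
  have "finite (s ` ?P)" "s ` ?P \<noteq> {}"
    using permutes_id[of "UNIV :: 'n set"] by (auto simp: finite_permutations simp del: permutes_id)
  then have "Max (s ` ?P) \<in> s ` ?P" by (rule Max_in)
  then obtain \<sigma> where \<sigma>: "\<sigma> permutes UNIV" and sm: "s \<sigma> = Max (s ` ?P)" by auto
  have max: "s \<tau> \<le> s \<sigma>" if "\<tau> permutes UNIV" for \<tau>
    unfolding sm using that by (auto simp: finite_permutations)
  have "x $ \<sigma> j \<le> x $ \<sigma> i" if ij: "i < j" for i j
  proof -
    let ?\<tau> = "\<sigma> \<circ> Transposition.transpose i j"
    let ?R = "UNIV - {i, j}"
    have U: "UNIV = insert i (insert j ?R)" by auto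
    have split: "(\<Sum>k\<in>UNIV. g k) = g i + g j + (\<Sum>k\<in>?R. g k)" for g :: "'n \<Rightarrow> real"
      using ij by (subst U, subst sum.insert) (auto simp: add.assoc)
    have "?\<tau> permutes UNIV"
      by (intro permutes_compose[OF permutes_swap_id \<sigma>]) auto
    then have "s ?\<tau> \<le> s \<sigma>" by (rule max)
    moreover have "(\<Sum>k\<in>?R. d k * x $ ?\<tau> k) = (\<Sum>k\<in>?R. d k * x $ \<sigma> k)"
      by (intro sum.cong) (auto simp: Transposition.transpose_def)
    ultimately have "d i * x $ \<sigma> j + d j * x $ \<sigma> i \<le> d i * x $ \<sigma> i + d j * x $ \<sigma> j"
      unfolding s_def split by (simp add: comp_def)
    then have "0 \<le> (d i - d j) * (x $ \<sigma> i - x $ \<sigma> j)" by (simp add: algebra_simps)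
    then show ?thesis using d[OF ij] by (simp add: zero_le_mult_iff)
  qed
  then have "permute_coords \<sigma> x \<in> F"
    using assms by (auto simp: F_def mem_box_cart le_less)
  with \<sigma> show ?thesis by blast
qed

text \<open>
  The sorted vector is unique, so the sorting permutations form a coset of the stabilizer of \<open>x\<close>.
\<close>
lemma card_sorting_permutations:
  fixes x :: "real^'n::{finite,wellorder}"
  assumes "x \<in> cbox 0 1"
  shows "card {\<sigma>. \<sigma> permutes UNIV \<and> permute_coords \<sigma> x \<in> F} = H x"
proof -
  obtain \<sigma> where \<sigma>: "\<sigma> permutes UNIV" "permute_coords \<sigma> x \<in> F"
    using ex_sorting_permutation[OF assms] by blast
  have inv: "inv \<sigma> permutes UNIV" by (rule permutes_inv[OF \<sigma>(1)])
  have uniq: "permute_coords \<tau> x = permute_coords \<sigma> x"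
    if "\<tau> permutes UNIV" "permute_coords \<tau> x \<in> F" for \<tau>
  proof (rule F_eqI[OF that(2) \<sigma>(2)])
    have "card {j. x $ \<rho>' j = a} = card {j. x $ j = a}" if "\<rho>' permutes UNIV" for \<rho>' and a
    proof -
      have "{j. x $ \<rho>' j = a} = \<rho>' -` {j. x $ j = a}" by auto
      then show ?thesis using that
        by (simp only:) (intro card_vimage_inj, auto simp: permutes_inj permutes_surj)
    qed
    then show "card {j. permute_coords \<tau> x $ j = a} = card {j. permute_coords \<sigma> x $ j = a}" for a
      using that(1) \<sigma>(1) by simp
  qed
  have "bij_betw (\<lambda>\<tau>. \<tau> \<circ> \<sigma>) {\<tau>. \<tau> permutes UNIV \<and> permute_coords \<tau> x = x}
     {\<tau>. \<tau> permutes UNIV \<and> permute_coords \<tau> x \<in> F}"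
  proof (rule bij_betwI[where g = "\<lambda>\<tau>. \<tau> \<circ> inv \<sigma>"])
    show "(\<lambda>\<tau>. \<tau> \<circ> \<sigma>) \<in> {\<tau>. \<tau> permutes UNIV \<and> permute_coords \<tau> x = x} \<rightarrow> {\<tau>. \<tau> permutes UNIV \<and> permute_coords \<tau> x \<in> F}"
    proof (intro Pi_I CollectI conjI)
      fix \<tau> assume "\<tau> \<in> {\<tau>. \<tau> permutes UNIV \<and> permute_coords \<tau> x = x}"
      then have \<tau>: "\<tau> permutes UNIV" "\<And>i. x $ \<tau> i = x $ i" by (auto simp: vec_eq_iff)
      show "\<tau> \<circ> \<sigma> permutes UNIV" by (rule permutes_compose[OF \<sigma>(1) \<tau>(1)])
      show "permute_coords (\<tau> \<circ> \<sigma>) x \<in> F" using \<sigma>(2) by (simp add: \<tau>(2))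
    qed
    show "(\<lambda>\<tau>. \<tau> \<circ> inv \<sigma>) \<in> {\<tau>. \<tau> permutes UNIV \<and> permute_coords \<tau> x \<in> F} \<rightarrow> {\<tau>. \<tau> permutes UNIV \<and> permute_coords \<tau> x = x}"
    proof (intro Pi_I CollectI conjI)
      fix \<tau> assume "\<tau> \<in> {\<tau>. \<tau> permutes UNIV \<and> permute_coords \<tau> x \<in> F}"
      then have \<tau>: "\<tau> permutes UNIV" "permute_coords \<tau> x \<in> F" by auto
      show "\<tau> \<circ> inv \<sigma> permutes UNIV" by (rule permutes_compose[OF inv \<tau>(1)])
      have "x $ \<tau> i = x $ \<sigma> i" for i using uniq[OF \<tau>] by (simp add: vec_eq_iff)
      then show "permute_coords (\<tau> \<circ> inv \<sigma>) x = x"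
        by (simp add: vec_eq_iff permutes_inverses(1)[OF \<sigma>(1)])
    qed
  qed (simp_all add: comp_assoc permutes_inv_o[OF \<sigma>(1)])
  then show ?thesis by (simp add: H_def bij_betw_same_card)
qed

lemma H_eq_1:
  assumes "inj (($) x)"
  shows "H x = 1"
proof -
  have "{\<sigma>. \<sigma> permutes UNIV \<and> permute_coords \<sigma> x = x} = {id}"
    using injD[OF assms] by (auto simp: vec_eq_iff permutes_id fun_eq_iff)
  then show ?thesis by (simp add: H_def)
qed

lemma H_pos: "H x > 0"
proof -
  have "id \<in> {\<sigma>. \<sigma> permutes UNIV \<and> permute_coords \<sigma> x = x}" by (auto simp: permutes_id)
  then show ?thesis unfolding H_def by (metis (no_types, lifting) card_gt_0_iff empty_iff finite)
qed

lemma sum_indicator_sorting: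
  fixes x :: "real^'n::{finite,wellorder}"
  assumes "x \<in> cbox 0 1"
  shows "(\<Sum>\<sigma> | \<sigma> permutes UNIV. if permute_coords \<sigma> x \<in> F then a else 0) = real (H x) * a"
  unfolding card_sorting_permutations[OF assms, symmetric]
  by (subst sum.inter_filter[symmetric]) (auto simp: finite_permutations)

text \<open>
  Permuting coordinates is orthogonal, so its determinant is \<open>\<plusminus>1\<close>.
\<close>
lemma integral_permute_coords:
  fixes g :: "real^'n::{finite,wellorder} \<Rightarrow> real"
  assumes "\<sigma> permutes UNIV" and g: "g absolutely_integrable_on cbox 0 1"
  shows "(\<lambda>x. g (permute_coords \<sigma> x)) absolutely_integrable_on cbox 0 1 \<and>
    integral (cbox 0 1) (\<lambda>x. g (permute_coords \<sigma> x)) = integral (cbox 0 1) g"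
proof -
  have lin: "linear (permute_coords \<sigma> :: real^'n::_ \<Rightarrow> _)"
    by (rule linearI) (simp_all add: vec_eq_iff)
  have "orthogonal_transformation (permute_coords \<sigma> :: real^'n::_ \<Rightarrow> _)"
  proof (unfold orthogonal_transformation_def, intro conjI lin allI)
    fix v w :: "real^'n::_"
    have "(\<Sum>i\<in>UNIV. v $ \<sigma> i * w $ \<sigma> i) = (\<Sum>i\<in>UNIV. v $ i * w $ i)"
      by (rule sum.reindex_bij_betw[OF permutes_bij[OF assms(1)]])
    then show "permute_coords \<sigma> v \<bullet> permute_coords \<sigma> w = v \<bullet> w" by (simp add: inner_vec_def)
  qed
  then have det: "\<bar>det (matrix (permute_coords \<sigma> :: real^'n::_ \<Rightarrow> _))\<bar> = 1"
    by (rule orthogonal_transformation_det)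
  have image: "permute_coords \<sigma> ` cbox 0 (1 :: real^'n::_) = cbox 0 1"
  proof (intro equalityI subsetI)
    fix y :: "real^'n::_" assume y: "y \<in> cbox 0 1"
    have "y = permute_coords \<sigma> (permute_coords (inv \<sigma>) y)"
      by (simp add: vec_eq_iff permutes_inverses[OF assms(1)])
    moreover have "permute_coords (inv \<sigma>) y \<in> cbox 0 1" using y by (simp add: mem_box_cart)
    ultimately show "y \<in> permute_coords \<sigma> ` cbox 0 1" by blast
  qed (auto simp: mem_box_cart)
  have "(\<lambda>x. \<bar>det (matrix (permute_coords \<sigma> :: real^'n::_ \<Rightarrow> _))\<bar> *\<^sub>R (vec (g (permute_coords \<sigma> x)) :: real^1)) absolutely_integrable_on cbox 0 1 \<and>
         integral (cbox 0 1) (\<lambda>x. \<bar>det (matrix (permute_coords \<sigma> :: real^'n::_ \<Rightarrow> _))\<bar> *\<^sub>R vec (g (permute_coords \<sigma> x))) = (vec (integral (cbox 0 1) g) :: real^1)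
     \<longleftrightarrow> (\<lambda>x. vec (g x) :: real^1) absolutely_integrable_on (permute_coords \<sigma> ` cbox 0 1) \<and>
         integral (permute_coords \<sigma> ` cbox 0 1) (\<lambda>x. vec (g x)) = (vec (integral (cbox 0 1) g) :: real^1)"
    by (rule has_absolute_integral_change_of_variables_linear[OF lin])
  then show ?thesis using g
    by (simp add: det image absolutely_integrable_on_1_iff integral_on_1_eq)
qed

text \<open>
  Summing the indicator of \<^const>\<open>F\<close> over all permutations of the coordinates gives the density
  \<^const>\<open>H\<close>, which is \<open>1\<close> almost everywhere.
\<close>
lemma integral_cube_eq_fact_integral_F:
  fixes g :: "real^'n::{finite,wellorder} \<Rightarrow> real"
  assumes cont: "continuous_on UNIV g"
    and sym: "\<And>\<sigma> x. \<sigma> permutes UNIV \<Longrightarrow> g (permute_coords \<sigma> x) = g x"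
  shows "integral (cbox 0 1) g = fact CARD('n) * integral F g"
proof -
  let ?g = "\<lambda>x. if x \<in> F then g x else 0"
  have F_cube: "F \<inter> cbox 0 1 = (F :: (real^'n::_) set)" using F_subset_cube by auto
  have abs: "?g absolutely_integrable_on cbox 0 1"
    using absolutely_integrable_on_F[OF cont]
    by (subst absolutely_integrable_restrict_UNIV[symmetric], subst (asm) absolutely_integrable_restrict_UNIV[symmetric])
       (erule back_subst[where P = "\<lambda>h. h absolutely_integrable_on UNIV"], use F_subset_cube in \<open>auto simp: fun_eq_iff\<close>)
  have int: "integral (cbox 0 1) ?g = integral F g"
    by (simp add: Henstock_Kurzweil_Integration.integral_restrict_Int F_cube)
  note perm = integral_permute_coords[OF _ abs]
  have H1: "real (H x) * g x = g x" if "x \<in> cbox 0 1 - {x. \<not> inj (($) x)}" for x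
    using that H_eq_1[of x] by simp
  have negl: "negligible {x :: real^'n::_. \<not> inj (($) x)}"
  proof -
    have "negligible {x :: real^'n::_. (axis (fst p) 1 - axis (snd p) 1) \<bullet> x = 0}"
      if "p \<in> {p. fst p \<noteq> snd p}" for p
    proof -
      have "axis (fst p) (1::real) \<noteq> axis (snd p) 1" using that by (auto simp: axis_eq_axis)
      then show ?thesis by (intro negligible_hyperplane) auto
    qed
    then have "negligible (\<Union>p\<in>{p. fst p \<noteq> snd p}. {x :: real^'n::_. (axis (fst p) 1 - axis (snd p) 1) \<bullet> x = 0})"
      by (intro negligible_Union finite_imageI finite) auto
    then show ?thesis
    proof (rule negligible_subset, intro subsetI)
      fix x :: "real^'n::_" assume "x \<in> {x. \<not> inj (($) x)}"
      then obtain i j where "i \<noteq> j" "x $ i = x $ j" by (auto simp: inj_def)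
      then show "x \<in> (\<Union>p\<in>{p. fst p \<noteq> snd p}. {x. (axis (fst p) 1 - axis (snd p) 1) \<bullet> x = 0})"
        by (intro UN_I[of "(i, j)"]) (simp_all add: inner_axis' inner_diff_left)
    qed
  qed
  have "fact CARD('n) * integral F g = (\<Sum>\<sigma> | \<sigma> permutes (UNIV :: 'n set). integral F g)"
    by (simp add: card_permutations)
  also have "\<dots> = (\<Sum>\<sigma> | \<sigma> permutes (UNIV :: 'n set). integral (cbox 0 1) (\<lambda>x. ?g (permute_coords \<sigma> x)))"
    using perm by (intro sum.cong refl) (simp add: int)
  also have "\<dots> = integral (cbox 0 1) (\<lambda>x. \<Sum>\<sigma> | \<sigma> permutes UNIV. ?g (permute_coords \<sigma> x))"
    using perm by (intro integral_sum[symmetric]) (auto simp: finite_permutations absolutely_integrable_on_def)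
  also have "\<dots> = integral (cbox 0 1) (\<lambda>x. real (H x) * g x)"
  proof (rule integral_cong)
    fix x :: "real^'n::_" assume x: "x \<in> cbox 0 1"
    have "(\<Sum>\<sigma> | \<sigma> permutes UNIV. ?g (permute_coords \<sigma> x))
       = (\<Sum>\<sigma> | \<sigma> permutes UNIV. if permute_coords \<sigma> x \<in> F then g x else 0)"
      by (intro sum.cong refl) (auto simp: sym)
    then show "(\<Sum>\<sigma> | \<sigma> permutes UNIV. ?g (permute_coords \<sigma> x)) = real (H x) * g x"
      using sum_indicator_sorting[OF x, of "g x"] by simp
  qed
  also have "\<dots> = integral (cbox 0 1) g"
    by (rule integral_spike[OF negl]) (use H1 in auto)
  finally show ?thesis by simp
qed

section \<open>Product grids and separable functions\<close>

definition grid :: "real set \<Rightarrow> (real^'n) set" where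
  "grid T = {s. \<forall>i. s $ i \<in> T}"

lemma grid_eq_image: "grid T = vec_lambda ` (PiE UNIV (\<lambda>_. T))"
proof (intro equalityI subsetI)
  fix s :: "real^'n" assume "s \<in> grid T"
  then have "vec_nth s \<in> PiE UNIV (\<lambda>_. T)" by (auto simp: grid_def)
  then show "s \<in> vec_lambda ` (PiE UNIV (\<lambda>_. T))" by (metis image_eqI vec_nth_inverse)
qed (auto simp: grid_def)

lemma finite_grid: "finite T \<Longrightarrow> finite (grid T :: (real^'n) set)"
  by (auto simp: grid_eq_image intro!: finite_PiE)

lemma sum_grid_prod:
  assumes "finite T"
  shows "(\<Sum>s\<in>(grid T :: (real^'n) set). \<Prod>i\<in>UNIV. h i (s $ i)) = (\<Prod>i\<in>UNIV. \<Sum>t\<in>T. h i t :: real)"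
proof -
  have "inj_on vec_lambda (PiE UNIV (\<lambda>_. T) :: ('n \<Rightarrow> real) set)"
    by (auto intro!: inj_onI simp: vec_lambda_inject)
  then show ?thesis
    by (simp add: grid_eq_image sum.reindex prod_sum_PiE[OF finite] assms)
qed

text \<open>
  The analogue of the integral formula for sums. Grid points with repeated coordinates now count, so
  the factor \<^const>\<open>H\<close> does not disappear.
\<close>
lemma sum_grid_eq_sum_F:
  fixes g :: "real^'n::{finite,wellorder} \<Rightarrow> real"
  assumes T: "finite T" "T \<subseteq> {0..1}"
    and sym: "\<And>\<sigma> x. \<sigma> permutes UNIV \<Longrightarrow> g (permute_coords \<sigma> x) = g x"
  shows "(\<Sum>s\<in>grid T. g s) = fact CARD('n) * (\<Sum>s\<in>F \<inter> grid T. inverse (real (H s)) * g s)"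
proof -
  let ?P = "{\<sigma>. \<sigma> permutes (UNIV :: 'n set)}"
  let ?G = "grid T :: (real^'n::_) set"
  have cube: "s \<in> cbox 0 1" if "s \<in> ?G" for s
    using that T by (auto simp: grid_def mem_box_cart)
  \<comment> \<open>As a sum over permutations the weight is visibly invariant under permuting the coordinates.\<close>
  define h where "h s = inverse (\<Sum>\<sigma>\<in>?P. if permute_coords \<sigma> s \<in> F then 1 else 0) * g s" for s
  have hH: "h s = inverse (real (H s)) * g s" if "s \<in> ?G" for s
    using sum_indicator_sorting[OF cube[OF that], of 1] by (simp add: h_def)
  have hsym: "h (permute_coords \<tau> s) = h s" if \<tau>: "\<tau> permutes UNIV" for \<tau> s
    using setum_permutations_compose_left[OF \<tau>, of "\<lambda>\<sigma>. if permute_coords \<sigma> s \<in> F then 1 else 0 :: real"]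
    by (simp add: h_def sym[OF \<tau>] comp_def)
  have "fact CARD('n) * (\<Sum>s\<in>F \<inter> ?G. inverse (real (H s)) * g s) = (\<Sum>\<sigma>\<in>?P. \<Sum>s\<in>F \<inter> ?G. h s)"
    by (simp add: card_permutations hH)
  also have "\<dots> = (\<Sum>\<sigma>\<in>?P. \<Sum>s\<in>?G. if permute_coords \<sigma> s \<in> F then h s else 0)"
  proof (rule sum.cong[OF refl])
    fix \<sigma> assume "\<sigma> \<in> ?P"
    then have \<sigma>: "\<sigma> permutes UNIV" by simp
    have bij: "bij_betw (permute_coords \<sigma>) ?G ?G"
      by (rule bij_betwI[where g = "permute_coords (inv \<sigma>)"])
         (auto simp: grid_def vec_eq_iff permutes_inverses[OF \<sigma>])
    have "(\<Sum>s\<in>F \<inter> ?G. h s) = (\<Sum>s\<in>?G. if s \<in> F then h s else 0)"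
      using finite_grid[OF T(1)] by (subst sum.inter_filter[symmetric]) (auto intro!: sum.cong)
    also have "\<dots> = (\<Sum>s\<in>?G. if permute_coords \<sigma> s \<in> F then h (permute_coords \<sigma> s) else 0)"
      by (rule sum.reindex_bij_betw[OF bij, symmetric])
    also have "\<dots> = (\<Sum>s\<in>?G. if permute_coords \<sigma> s \<in> F then h s else 0)"
      by (intro sum.cong refl if_cong hsym[OF \<sigma>])
    finally show "(\<Sum>s\<in>F \<inter> ?G. h s) = (\<Sum>s\<in>?G. if permute_coords \<sigma> s \<in> F then h s else 0)" .
  qed
  also have "\<dots> = (\<Sum>s\<in>?G. \<Sum>\<sigma>\<in>?P. if permute_coords \<sigma> s \<in> F then h s else 0)"
    by (rule sum.swap)
  also have "\<dots> = (\<Sum>s\<in>?G. g s)"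
  proof (rule sum.cong[OF refl])
    fix s assume s: "s \<in> ?G"
    show "(\<Sum>\<sigma>\<in>?P. if permute_coords \<sigma> s \<in> F then h s else 0) = g s"
      using H_pos[of s] sum_indicator_sorting[OF cube[OF s], of "h s"] by (simp add: hH[OF s])
  qed
  finally show ?thesis by simp
qed

text \<open>
  Fubini's theorem, through the definition of Lebesgue measure as a product over the basis vectors.
\<close>
lemma integral_cube_prod:
  fixes h :: "'n::finite \<Rightarrow> real \<Rightarrow> real"
  assumes cont: "\<And>i. continuous_on UNIV (h i)"
  shows "integral (cbox 0 (1 :: real^'n)) (\<lambda>x. \<Prod>i\<in>UNIV. h i (x $ i)) = (\<Prod>i\<in>UNIV. integral {0..1} (h i))"
proof -
  define u where "u i t = indicator {0..1} t *\<^sub>R h i t" for i t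
  have u_int: "integrable lborel (u i)" for i
    unfolding u_def using cont by (intro borel_integrable_compact) (auto intro: continuous_on_subset)
  then have u_meas [measurable]: "u i \<in> borel_measurable borel" for i by auto
  have u_eq: "(\<integral>t. u i t \<partial>lborel) = integral {0..1} (h i)" for i
    using set_borel_integral_eq_integral(2)[of "{0..1}" "h i"] u_int[of i]
    unfolding u_def set_integrable_def set_lebesgue_integral_def by blast
  have Basis: "(Basis :: (real^'n) set) = range (\<lambda>i. axis i 1)"
    by (auto simp: Basis_vec_def)
  have inj: "inj (\<lambda>i::'n. axis i (1::real))" by (auto intro!: injI simp: axis_eq_axis)
  define v where "v b = u (inv (\<lambda>i. axis i 1) b)" for b :: "real^'n"
  have v: "v (axis i 1) = u i" for i by (simp add: v_def inv_f_f[OF inj])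
  have v_meas [measurable]: "v b \<in> borel_measurable borel" for b by (simp add: v_def)
  interpret product_sigma_finite "\<lambda>_ :: real^'n. lborel :: real measure" ..
  let ?f = "\<lambda>x :: real^'n. \<Prod>i\<in>UNIV. h i (x $ i)"
  have ind: "indicator (cbox 0 1) x *\<^sub>R ?f x = (\<Prod>b\<in>Basis. v b (x \<bullet> b))" for x :: "real^'n"
  proof -
    have "(\<Prod>b\<in>Basis. v b (x \<bullet> b)) = (\<Prod>i\<in>UNIV. indicator {0..1} (x $ i) * h i (x $ i))"
      by (simp add: Basis prod.reindex[OF inj] v inner_axis u_def)
    also have "\<dots> = (\<Prod>i\<in>UNIV. indicator {0..1} (x $ i)) * ?f x" by (rule prod.distrib)
    also have "(\<Prod>i\<in>UNIV. indicator {0..1} (x $ i)) = (indicator (cbox 0 1) x :: real)"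
      by (auto simp: indicator_def mem_box_cart prod_zero_iff)
    finally show ?thesis by simp
  qed
  have "continuous_on (cbox 0 1) ?f"
    by (intro continuous_intros continuous_on_compose2[OF cont]) auto
  then have si: "set_integrable lborel (cbox 0 1) ?f"
    unfolding set_integrable_def by (intro borel_integrable_compact) auto
  have "integral (cbox 0 1) ?f = (\<integral>x. indicator (cbox 0 1) x *\<^sub>R ?f x \<partial>lborel)"
    using set_borel_integral_eq_integral(2)[OF si] by (simp add: set_lebesgue_integral_def)
  also have "\<dots> = (\<integral>x. (\<Prod>b\<in>Basis. v b (x \<bullet> b)) \<partial>lborel)" by (simp only: ind)
  also have "\<dots> = (\<integral>y. (\<Prod>b\<in>Basis. v b (y b)) \<partial>(\<Pi>\<^sub>M b\<in>(Basis :: (real^'n) set). lborel))"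
    by (subst lborel_eq, subst integral_distr) (auto intro!: Bochner_Integration.integral_cong prod.cong)
  also have "\<dots> = (\<Prod>b\<in>Basis. \<integral>t. v b t \<partial>lborel)"
    by (rule product_integral_prod) (auto simp: v_def u_int)
  also have "\<dots> = (\<Prod>i\<in>UNIV. integral {0..1} (h i))"
    by (simp add: Basis prod.reindex[OF inj] v u_eq)
  finally show ?thesis .
qed

text \<open>
  The linear span of the products of functions in \<open>U\<close> of the single coordinates. An identity between
  a product integral and a product sum has to be checked only on \<open>U\<close>.
\<close>
inductive separable :: "(real \<Rightarrow> real) set \<Rightarrow> (real^'n::finite \<Rightarrow> real) \<Rightarrow> bool" for U where
  prod: "(\<And>i. h i \<in> U) \<Longrightarrow> separable U (\<lambda>x. \<Prod>i\<in>UNIV. h i (x $ i))"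
| scale: "separable U g \<Longrightarrow> separable U (\<lambda>x. a * g x)"
| add: "separable U g \<Longrightarrow> separable U h \<Longrightarrow> separable U (\<lambda>x. g x + h x)"

lemma separable_mono: "separable U g \<Longrightarrow> U \<subseteq> V \<Longrightarrow> separable V g"
proof (induction rule: separable.induct)
  case (prod h)
  then show ?case by (intro separable.prod) auto
qed (auto intro: separable.scale separable.add)

lemma separable_mult:
  assumes UV: "\<And>u v. u \<in> U \<Longrightarrow> v \<in> V \<Longrightarrow> (\<lambda>t. u t * v t) \<in> W"
    and "separable U g" "separable V h"
  shows "separable W (\<lambda>x. g x * h x)"
  using assms(2)
proof (induction rule: separable.induct)
  case (prod u)
  show ?case using assms(3)
  proof (induction rule: separable.induct)
    case (prod v)
    have "separable W (\<lambda>x. \<Prod>i\<in>UNIV. u i (x $ i) * v i (x $ i))"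
      by (rule separable.prod[of "\<lambda>i t. u i t * v i t"]) (intro UV prod \<open>\<And>i. u i \<in> U\<close>)
    then show ?case by (simp add: prod.distrib)
  next
    case (scale g a)
    then show ?case using separable.scale[OF scale.IH, of a] by (simp add: mult_ac)
  next
    case (add g h)
    then show ?case using separable.add[OF add.IH] by (simp add: distrib_left)
  qed
next
  case (scale g a)
  then show ?case using separable.scale[OF scale.IH, of a] by (simp add: mult.assoc)
next
  case (add g1 g2)
  then show ?case using separable.add[OF add.IH] by (simp add: distrib_right)
qed

lemma separable_sum:
  assumes "U \<noteq> {}" "\<And>a. a \<in> A \<Longrightarrow> separable U (g a)"
  shows "separable U (\<lambda>x. \<Sum>a\<in>A. g a x)"
proof -
  obtain u where "u \<in> U" using assms(1) by blast
  then have zero: "separable U (\<lambda>x. 0)"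
    using separable.scale[OF separable.prod[of "\<lambda>_. u"], of U 0] by simp
  show ?thesis using assms(2)
    by (induction A rule: infinite_finite_induct) (auto intro: zero separable.add)
qed

lemma separable_continuous:
  assumes "\<And>u. u \<in> U \<Longrightarrow> continuous_on UNIV u" "separable U g"
  shows "continuous_on UNIV g"
  using assms(2)
proof (induction rule: separable.induct)
  case (prod h)
  have "continuous_on UNIV (\<lambda>x. h i (x $ i))" for i
    by (rule continuous_on_compose2[OF assms(1)[OF prod]]) (auto intro: continuous_intros)
  then show ?case by (intro continuous_on_prod)
qed (rule continuous_on_mult_left continuous_on_add; assumption)+

lemma separable_cubature:
  fixes g :: "real^'n \<Rightarrow> real"
  assumes T: "finite T"
    and cont: "\<And>u. u \<in> U \<Longrightarrow> continuous_on UNIV u"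
    and exact: "\<And>u. u \<in> U \<Longrightarrow> integral {0..1} u = q * (\<Sum>t\<in>T. u t)"
    and "separable U g"
  shows "integral (cbox 0 1) g = q ^ CARD('n) * (\<Sum>s\<in>grid T. g s)"
  using assms(4)
proof (induction rule: separable.induct)
  case (prod h)
  then have "integral (cbox 0 1) (\<lambda>x. \<Prod>i\<in>UNIV. h i (x $ i)) = (\<Prod>i\<in>UNIV. q * (\<Sum>t\<in>T. h i t))"
    by (subst integral_cube_prod) (auto intro: cont simp: exact)
  then show ?case by (simp add: prod.distrib sum_grid_prod[OF T])
next
  case (scale g a)
  then show ?case by (simp flip: sum_distrib_left)
next
  case (add g h)
  have "k integrable_on cbox 0 1" if "separable U k" for k :: "real^'n \<Rightarrow> real"
    using separable_continuous[OF cont that] by (intro integrable_continuous) (auto intro: continuous_on_subset)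
  then show ?case using add by (simp add: integral_add sum.distrib distrib_left)
qed

definition cos_powers :: "nat \<Rightarrow> (real \<Rightarrow> real) set" where
  "cos_powers d = {\<lambda>t. cos (pi * t) ^ m |m. m \<le> d}"

lemma cos_power_in_cos_powers: "m \<le> d \<Longrightarrow> (\<lambda>t. cos (pi * t) ^ m) \<in> cos_powers d"
  unfolding cos_powers_def by blast

lemma cos_powers_mult:
  assumes "u \<in> cos_powers a" "v \<in> cos_powers b"
  shows "(\<lambda>t. u t * v t) \<in> cos_powers (a + b)"
proof -
  obtain m k where "u = (\<lambda>t. cos (pi * t) ^ m)" "m \<le> a" "v = (\<lambda>t. cos (pi * t) ^ k)" "k \<le> b"
    using assms unfolding cos_powers_def by blast
  then show ?thesis using cos_power_in_cos_powers[of "m + k" "a + b"] by (simp add: power_add)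
qed

lemma cos_powers_mono:
  assumes "a \<le> b"
  shows "cos_powers a \<subseteq> cos_powers b"
proof
  fix u assume "u \<in> cos_powers a"
  then obtain m where "u = (\<lambda>t. cos (pi * t) ^ m)" "m \<le> a" unfolding cos_powers_def by blast
  then show "u \<in> cos_powers b" using assms cos_power_in_cos_powers[of m b] by simp
qed

lemma cos_powers_nonempty: "cos_powers d \<noteq> {}"
  using cos_power_in_cos_powers[of 0 d] by blast

abbreviation cos_factors :: "real^'n \<Rightarrow> (real \<Rightarrow> real) set" where
  "cos_factors l \<equiv> range (\<lambda>j t. cos (pi * l $ j * t))"

lemma separable_cos_term: "separable (cos_factors l) (\<lambda>x. \<Prod>i\<in>UNIV. cos (pi * l $ \<sigma> i * x $ i))"
proof (rule separable.prod[where h = "\<lambda>i t. cos (pi * l $ \<sigma> i * t)" and U = "cos_factors l"])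
  show "(\<lambda>t. cos (pi * l $ \<sigma> i * t)) \<in> cos_factors l" for i
    by (rule image_eqI[of _ _ "\<sigma> i"]) (rule refl, rule UNIV_I)
qed

lemma separable_cos_minus: "separable (cos_factors l) (cos_minus l)"
  unfolding cos_minus_def[abs_def]
  by (rule separable_sum, blast, rule separable.scale, rule separable_cos_term)

lemma separable_cos_plus: "separable (cos_factors l) (cos_plus l)"
  unfolding cos_plus_def[abs_def]
  by (rule separable_sum, blast, rule separable_cos_term)

text \<open>
  Every \<open>X\<^sub>j\<close> has degree at most one in each cosine. This is why the total degree of \<open>f\<close> bounds the
  degree of \<open>f(\<phi>(x))\<close> in each single cosine.
\<close>
lemma separable_X: "separable (cos_powers 1) (X j)"
  unfolding X_def
proof (rule separable_mono[OF separable_cos_plus], rule image_subsetI)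
  fix k :: 'a
  show "(\<lambda>t. cos (pi * (\<chi> i. if i \<le> j then 1 else 0) $ k * t)) \<in> cos_powers 1"
    using cos_power_in_cos_powers[of 0 1] cos_power_in_cos_powers[of 1 1] by simp
qed

lemma separable_one: "separable (cos_powers 0) (\<lambda>x. 1)"
proof -
  have "(\<lambda>t. 1) \<in> cos_powers 0" using cos_power_in_cos_powers[of 0 0] by simp
  then show ?thesis using separable.prod[of "\<lambda>_ _. 1" "cos_powers 0"] by simp
qed

lemma separable_monomial:
  fixes m :: "'n::{finite,wellorder} \<Rightarrow> nat"
  assumes "finite A"
  shows "separable (cos_powers (\<Sum>i\<in>A. m i)) (\<lambda>x. \<Prod>i\<in>A. X i x ^ m i)"
  using assms
proof (induction A rule: finite_induct)
  case (insert i A)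
  have "separable (cos_powers k) (\<lambda>x. X i x ^ k)" for k
  proof (induction k)
    case (Suc k)
    have "separable (cos_powers (1 + k)) (\<lambda>x. X i x * X i x ^ k)"
      by (rule separable_mult[OF _ separable_X Suc]) (rule cos_powers_mult)
    then show ?case by simp
  qed (simp add: separable_one)
  then have "separable (cos_powers (m i + (\<Sum>i\<in>A. m i))) (\<lambda>x. X i x ^ m i * (\<Prod>i\<in>A. X i x ^ m i))"
    by (rule separable_mult[OF _ _ insert.IH, rotated]) (rule cos_powers_mult)
  with insert.hyps show ?case by simp
qed (simp add: separable_one)

lemma separable_eval_rpoly:
  assumes "degree_at_most f (int d)"
  shows "separable (cos_powers d) (\<lambda>x. eval_rpoly f (phi x))"
  unfolding eval_rpoly_def
proof (intro separable_sum separable.scale cos_powers_nonempty)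
  fix m assume "m \<in> Poly_Mapping.keys f"
  then have "(\<Sum>i\<in>UNIV. Poly_Mapping.lookup m i) \<le> d"
    using assms unfolding degree_at_most_def by (metis of_nat_le_iff)
  from separable_mono[OF separable_monomial[OF finite] cos_powers_mono[OF this]]
  show "separable (cos_powers d) (\<lambda>x. \<Prod>i\<in>UNIV. phi x $ i ^ Poly_Mapping.lookup m i)"
    by (simp add: phi_def)
qed

lemma phi_permute:
  assumes "\<sigma> permutes UNIV"
  shows "phi (permute_coords \<sigma> x) = phi x"
proof -
  have "(\<Prod>i\<in>UNIV. [:1, cosvec x (\<sigma> i):]) = (\<Prod>i\<in>UNIV. [:1, cosvec x i:])"
    by (rule prod.reindex_bij_betw[OF permutes_bij[OF assms]])
  then show ?thesis by (simp add: phi_def X_eq_esym esym_def)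
qed

section \<open>Reduction to one variable\<close>

lemma cubature_F:
  fixes f :: "'n::{finite,wellorder} rpoly" and W :: "real^'n::_ \<Rightarrow> real"
  assumes deg: "degree_at_most f (int d)"
    and T: "finite T" "T \<subseteq> {0..1}"
    and W: "separable U W" "\<And>\<sigma> x. \<sigma> permutes UNIV \<Longrightarrow> W (permute_coords \<sigma> x) = W x"
    and cont: "\<And>u. u \<in> U \<Longrightarrow> continuous_on UNIV u"
    and exact: "\<And>u m. u \<in> U \<Longrightarrow> m \<le> d \<Longrightarrow>
      integral {0..1} (\<lambda>t. cos (pi * t) ^ m * u t) = q * (\<Sum>t\<in>T. cos (pi * t) ^ m * u t)"
  shows "continuous_on UNIV (\<lambda>x. eval_rpoly f (phi x) * W x)"
    and "integral F (\<lambda>x. eval_rpoly f (phi x) * W x)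
      = q ^ CARD('n) * (\<Sum>s\<in>F \<inter> grid T. inverse (real (H s)) * (eval_rpoly f (phi s) * W s))"
proof -
  let ?g = "\<lambda>x. eval_rpoly f (phi x) * W x"
  define V where "V = {\<lambda>t. cos (pi * t) ^ m * u t |m u. m \<le> d \<and> u \<in> U}"
  have sep: "separable V ?g"
    by (rule separable_mult[OF _ separable_eval_rpoly[OF deg] W(1)])
       (auto simp: V_def cos_powers_def)
  have contV: "continuous_on UNIV v" if "v \<in> V" for v
    using that cont by (auto simp: V_def intro!: continuous_intros)
  have exactV: "integral {0..1} v = q * (\<Sum>t\<in>T. v t)" if "v \<in> V" for v
    using that exact by (auto simp: V_def)
  show contg: "continuous_on UNIV ?g"
    by (rule separable_continuous[OF contV sep])
  have sym: "?g (permute_coords \<sigma> x) = ?g x" if "\<sigma> permutes UNIV" for \<sigma> x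
    using that by (simp add: phi_permute W(2))
  have "fact CARD('n) * integral F ?g = integral (cbox 0 1) ?g"
    by (rule integral_cube_eq_fact_integral_F[OF contg sym, symmetric])
  also have "\<dots> = q ^ CARD('n) * (\<Sum>s\<in>grid T. ?g s)"
    by (rule separable_cubature[OF T(1) contV exactV sep])
  also have "\<dots> = fact CARD('n) * (q ^ CARD('n) * (\<Sum>s\<in>F \<inter> grid T. inverse (real (H s)) * ?g s))"
    by (simp add: sum_grid_eq_sum_F[OF T sym])
  finally show "integral F ?g = q ^ CARD('n) * (\<Sum>s\<in>F \<inter> grid T. inverse (real (H s)) * ?g s)"
    by simp
qed

lemma HH_phi: "s \<in> F \<Longrightarrow> HH (phi s) = H s"
  by (simp add: HH_def the_inv_into_f_f[OF inj_on_phi])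

text \<open>
  The common form of the four formulas: \<open>W\<close> is the weight in the variables \<open>x\<close>, \<open>P\<close> the same weight as a
  polynomial in \<open>Y\<close>, and \<open>U\<close> contains the one-variable factors of \<open>W\<close>.
\<close>
lemma cubature_FF:
  fixes f P :: "'n::{finite,wellorder} rpoly" and W :: "real^'n::_ \<Rightarrow> real"
  assumes deg: "degree_at_most f (int d)"
    and T: "finite T" "T \<subseteq> {0..1}"
    and W: "separable U W" "\<And>\<sigma> x. \<sigma> permutes UNIV \<Longrightarrow> W (permute_coords \<sigma> x) = W x"
    and cont: "\<And>u. u \<in> U \<Longrightarrow> continuous_on UNIV u"
    and exact: "\<And>u m. u \<in> U \<Longrightarrow> m \<le> d \<Longrightarrow>
      integral {0..1} (\<lambda>t. cos (pi * t) ^ m * u t) = q * (\<Sum>t\<in>T. cos (pi * t) ^ m * u t)"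
    and P: "\<And>x. x \<in> F \<Longrightarrow> eval_rpoly P (phi x) = W x"
  shows "set_integrable lebesgue FF (\<lambda>Y. eval_rpoly f Y * (eval_rpoly P Y / JJ Y))"
    and "(LINT Y:FF|lebesgue. eval_rpoly f Y * (eval_rpoly P Y / JJ Y))
      = q ^ CARD('n) * (\<Sum>Y\<in>phi ` (F \<inter> grid T). inverse (real (HH Y)) * eval_rpoly f Y * eval_rpoly P Y)"
proof -
  note F = cubature_F[OF deg T W cont exact]
  have FF: "set_integrable lebesgue FF (\<lambda>Y. eval_rpoly f Y * (eval_rpoly P Y / JJ Y)) \<and>
    (LINT Y:FF|lebesgue. eval_rpoly f Y * (eval_rpoly P Y / JJ Y)) = integral F (\<lambda>x. eval_rpoly f (phi x) * W x)"
    by (rule integral_FF) (simp_all add: F(1) P JJ_phi)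
  then show "set_integrable lebesgue FF (\<lambda>Y. eval_rpoly f Y * (eval_rpoly P Y / JJ Y))" by blast
  have "inj_on phi (F \<inter> grid T :: (real^'n::_) set)" by (rule inj_on_subset[OF inj_on_phi]) auto
  then have "(\<Sum>Y\<in>phi ` (F \<inter> grid T). inverse (real (HH Y)) * eval_rpoly f Y * eval_rpoly P Y)
     = (\<Sum>s\<in>F \<inter> grid T. inverse (real (H s)) * (eval_rpoly f (phi s) * W s))"
    by (simp add: sum.reindex HH_phi P mult.assoc)
  with FF F(2) show "(LINT Y:FF|lebesgue. eval_rpoly f Y * (eval_rpoly P Y / JJ Y))
      = q ^ CARD('n) * (\<Sum>Y\<in>phi ` (F \<inter> grid T). inverse (real (HH Y)) * eval_rpoly f Y * eval_rpoly P Y)"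
    by simp
qed

text \<open>
  An antisymmetric weight vanishes at nodes with repeated coordinates. The remaining nodes have trivial
  stabilizer, which explains the missing factor \<open>1/H\<close> in the antisymmetric formulas.
\<close>
lemma sum_strict_nodes:
  assumes T: "finite T" and P: "\<And>s. s \<in> F \<Longrightarrow> \<not> inj (($) s) \<Longrightarrow> eval_rpoly P (phi s) = 0"
  shows "(\<Sum>Y\<in>phi ` (F \<inter> grid T). inverse (real (HH Y)) * eval_rpoly f Y * eval_rpoly P Y)
    = (\<Sum>Y\<in>phi ` {s \<in> F \<inter> grid T. inj (($) s)}. eval_rpoly f Y * eval_rpoly P Y)"
proof (rule sum.mono_neutral_cong_right)
  show "finite (phi ` (F \<inter> grid T))"
    by (intro finite_imageI finite_Int disjI2 finite_grid T)
  show "\<forall>Y\<in>phi ` (F \<inter> grid T) - phi ` {s \<in> F \<inter> grid T. inj (($) s)}.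
      inverse (real (HH Y)) * eval_rpoly f Y * eval_rpoly P Y = 0"
    using P by auto
qed (auto simp: HH_phi H_eq_1)

lemma cos_minus_eq_0:
  assumes "\<not> inj (($) x)"
  shows "cos_minus l x = 0"
proof -
  obtain i j where "i \<noteq> j" "x $ i = x $ j" using assms by (auto simp: inj_def)
  then show ?thesis unfolding cos_minus_eq_det
    by (intro det_identical_rows[of i j]) (simp_all add: row_def)
qed

lemma cos_minus_sq_permute:
  fixes x :: "real^'n::finite"
  assumes "\<sigma> permutes UNIV"
  shows "(cos_minus l (permute_coords \<sigma> x))\<^sup>2 = (cos_minus l x)\<^sup>2"
proof -
  let ?A = "(\<chi> i j. cos (pi * l $ j * x $ i)) :: real^'n^'n"
  have "cos_minus l (permute_coords \<sigma> x) = det ((\<chi> i. ?A $ \<sigma> i) :: real^'n^'n)"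
    by (simp add: cos_minus_eq_det)
  also have "\<dots> = of_int (sign \<sigma>) * cos_minus l x"
    using det_permute_rows[OF assms, of ?A] by (simp add: cos_minus_eq_det)
  finally show ?thesis by (cases "evenperm \<sigma>") (simp_all add: sign_def)
qed

lemma cos_plus_rho: "cos_plus rho (x :: real^'n) = fact CARD('n) * (\<Prod>i\<in>UNIV. cos (pi * (1/2) * x $ i))"
  by (simp add: cos_plus_def rho_def card_permutations)

text \<open>
  A product of two cosines is half a sum of cosines of the sum and the difference of the frequencies.
  These are integers even if, as for \<^const>\<open>rho2\<close>, the frequencies are not.
\<close>
lemma poly_in_phi_cos_minus_sq:
  fixes l :: "real^'n::{finite,wellorder}"
  assumes "\<And>i j. l $ i + l $ j \<in> \<int>" "\<And>i j. l $ i - l $ j \<in> \<int>"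
  shows "poly_in_phi (\<lambda>x. (cos_minus l x)\<^sup>2)"
  unfolding cos_minus_eq_det
proof (rule poly_in_phi_det_squared)
  fix j k
  obtain a b where ab: "l $ j + l $ k = of_int a" "l $ j - l $ k = of_int b"
    using assms[of j k] by (auto elim!: Ints_cases)
  have "cos (pi * l $ j * t) * cos (pi * l $ k * t)
      = (1/2) * (cos (of_int b * (pi * t)) + cos (of_int a * (pi * t)))" for t
    unfolding ab[symmetric] using cos_times_cos[of "pi * l $ j * t" "pi * l $ k * t"]
    by (simp add: algebra_simps)
  then show "poly_family (\<lambda>i x. (\<chi> i j. cos (pi * l $ j * x $ i)) $ i $ j * (\<chi> i j. cos (pi * l $ j * x $ i)) $ i $ k)"
    by (simp only: vec_lambda_beta)
       (intro poly_family.scale poly_family.add poly_family_cos_multiple poly_in_phi_const)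
qed

text \<open>
  By the half-angle formula the square is a multiple of \<open>\<Prod>(1 + c\<^sub>i)\<close>, the sum of all elementary
  symmetric polynomials.
\<close>
lemma poly_in_phi_cos_plus_rho_sq: "poly_in_phi (\<lambda>x::real^'n::{finite,wellorder}. (cos_plus rho x)\<^sup>2)"
proof -
  have "(cos_plus rho x)\<^sup>2 = (fact CARD('n))\<^sup>2 * (1/2) ^ CARD('n) * (\<Sum>k\<le>CARD('n). esym (cosvec x) UNIV k)"
    for x :: "real^'n::_"
  proof -
    have "(\<Prod>i\<in>UNIV. cos (pi * (1/2) * x $ i))\<^sup>2 = (\<Prod>i\<in>UNIV. (1/2) * (1 + cosvec x i))"
      unfolding prod_power_distrib
    proof (rule prod.cong[OF refl])
      fix i show "(cos (pi * (1/2) * x $ i))\<^sup>2 = (1/2) * (1 + cosvec x i)"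
        using cos_double_cos[of "pi * (1/2) * x $ i"] by simp
    qed
    also have "\<dots> = (1/2) ^ CARD('n) * (\<Prod>i\<in>UNIV. 1 + cosvec x i)" by (simp only: prod.distrib prod_constant)
    also have "(\<Prod>i\<in>UNIV. 1 + cosvec x i) = poly (\<Prod>i\<in>UNIV. [:1, cosvec x i:]) 1"
      by (simp add: poly_prod)
    also have "\<dots> = (\<Sum>k\<le>CARD('n). esym (cosvec x) UNIV k)"
    proof -
      have "degree (\<Prod>i\<in>UNIV. [:1, cosvec x i:]) \<le> (\<Sum>i\<in>(UNIV :: 'n set). 1)"
        by (rule order_trans[OF degree_prod_sum_le sum_mono]) auto
      then show ?thesis unfolding poly_altdef esym_def
        by (intro sum.mono_neutral_cong_left) (auto simp: coeff_eq_0)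
    qed
    finally show ?thesis by (simp add: cos_plus_rho power_mult_distrib)
  qed
  then show ?thesis
    by (simp only:) (intro poly_in_phi_mult poly_in_phi_const poly_in_phi_sum poly_in_phi_esym)
qed

text \<open>
  An increasing enumeration \<open>a\<close> of the one-dimensional nodes carries the ordered index vectors to the
  points of the product grid in \<^const>\<open>F\<close>, and the strictly ordered ones to those with distinct
  coordinates.
\<close>
lemma nodes_D_plus:
  fixes a :: "int \<Rightarrow> real"
  assumes mono: "strict_mono a" and a01: "\<And>r. 0 \<le> r \<Longrightarrow> r < int N \<Longrightarrow> 0 \<le> a r \<and> a r \<le> 1"
  shows "(\<lambda>r::int^'n::{finite,wellorder}. \<chi> i. a (r $ i)) ` D_plus N = F \<inter> grid (a ` {0..<int N})"
    and "(\<lambda>r::int^'n::_. \<chi> i. a (r $ i)) ` D_minus N = {s \<in> F \<inter> grid (a ` {0..<int N}). inj (($) s)}"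
proof -
  let ?a = "\<lambda>r::int^'n::_. \<chi> i. a (r $ i)"
  have mem: "?a r \<in> F \<inter> grid (a ` {0..<int N})" if "r \<in> D_plus N" for r
  proof -
    have "0 \<le> r $ i" "r $ i < int N" for i
      using that by (auto simp: D_plus_def)
    moreover have "r $ j \<le> r $ i" if "i \<le> j" for i j
      using that \<open>r \<in> D_plus N\<close> by (cases "i = j") (auto simp: D_plus_def)
    ultimately show ?thesis
      using a01 by (auto simp: F_def grid_def strict_mono_less_eq[OF mono])
  qed
  have preimage: "\<exists>r. s = ?a r \<and> r \<in> D_plus N" if "s \<in> F \<inter> grid (a ` {0..<int N})" for s
  proof -
    have "\<forall>i. \<exists>r\<in>{0..<int N}. s $ i = a r" using that by (auto simp: grid_def image_iff)
    then obtain r where "\<And>i. r i \<in> {0..<int N}" "\<And>i. s $ i = a (r i)" by metis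
    then have r: "\<And>i. s $ i = a (r i)" "\<And>i. 0 \<le> r i" "\<And>i. r i < int N" by auto
    have "s = ?a (\<chi> i. r i)" by (simp add: vec_eq_iff r(1))
    moreover have "(\<chi> i. r i) \<in> D_plus N"
    proof -
      have "r j \<le> r i" if "i < j" for i j
      proof -
        have "s $ j \<le> s $ i" using \<open>s \<in> _\<close> that by (auto simp: F_def)
        then show ?thesis by (simp add: r(1) strict_mono_less_eq[OF mono])
      qed
      then show ?thesis using r(2,3) by (auto simp: D_plus_def)
    qed
    ultimately show ?thesis by blast
  qed
  show "?a ` D_plus N = F \<inter> grid (a ` {0..<int N})" using mem preimage by blast
  have minus: "r \<in> D_minus N \<longleftrightarrow> r \<in> D_plus N \<and> inj (($) (?a r))" for r
  proof
    assume r: "r \<in> D_minus N"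
    have "inj (($) r)"
    proof (rule linorder_injI)
      fix i j :: 'n assume "i < j"
      then have "r $ j < r $ i" using r by (auto simp: D_minus_def)
      then show "r $ i \<noteq> r $ j" by simp
    qed
    then have "inj (($) (?a r))"
      using strict_mono_eq[OF mono] by (auto simp: inj_def)
    with r show "r \<in> D_plus N \<and> inj (($) (?a r))" by (auto simp: D_minus_def D_plus_def less_imp_le)
  next
    assume r: "r \<in> D_plus N \<and> inj (($) (?a r))"
    have "r $ j < r $ i" if "i < j" for i j
    proof -
      have "r $ j \<le> r $ i" using r that by (auto simp: D_plus_def)
      moreover have "r $ j \<noteq> r $ i" using r that injD[of "($) (?a r)" i j] by auto
      ultimately show ?thesis by simp
    qed
    then show "r \<in> D_minus N" using r by (auto simp: D_minus_def D_plus_def)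
  qed
  show "?a ` D_minus N = {s \<in> F \<inter> grid (a ` {0..<int N}). inj (($) s)}"
    using mem preimage minus by blast
qed

section \<open>Quadrature in one variable\<close>

text \<open>
  The end point \<open>1\<close> has a weight \<open>v\<close> of its own, since the rule of type VIII is exact up to the
  degree \<open>2N\<close> only with it.
\<close>
definition exact_rule :: "real \<Rightarrow> real set \<Rightarrow> real \<Rightarrow> (real \<Rightarrow> real) \<Rightarrow> bool" where
  "exact_rule q T v h \<longleftrightarrow> continuous_on UNIV h \<and> integral {0..1} h = q * (\<Sum>t\<in>T. h t) + v * h 1"

lemma exact_rule_scale: "exact_rule q T v h \<Longrightarrow> exact_rule q T v (\<lambda>t. a * h t)"
  unfolding exact_rule_def
  by (auto intro: continuous_on_mult_left simp: algebra_simps simp flip: sum_distrib_left)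

lemma exact_rule_add:
  assumes "exact_rule q T v g" "exact_rule q T v h"
  shows "exact_rule q T v (\<lambda>t. g t + h t)"
proof -
  have "k integrable_on {0..1}" if "exact_rule q T v k" for k
    using that integrable_continuous_real continuous_on_subset unfolding exact_rule_def by blast
  then show ?thesis using assms unfolding exact_rule_def
    by (auto intro: continuous_on_add simp: integral_add sum.distrib algebra_simps)
qed

text \<open>
  Multiplication by \<open>cos (\<pi> t)\<close> spreads a frequency to its two neighbours, so \<open>m\<close> such factors raise it
  by at most \<open>m\<close>. Negative frequencies are included to keep the recursion uniform.
\<close>
lemma exact_rule_cos_power:
  assumes base: "\<And>k::int. \<bar>k\<bar> \<le> D \<Longrightarrow> exact_rule q T v (\<lambda>t. cos (of_int k * (pi * t)))"
    and "int m + \<bar>k\<bar> \<le> D"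
  shows "exact_rule q T v (\<lambda>t. cos (pi * t) ^ m * cos (of_int k * (pi * t)))"
  using assms(2)
proof (induction m arbitrary: k)
  case 0
  then show ?case using base[of k] by simp
next
  case (Suc m)
  have "cos (pi * t) ^ Suc m * cos (of_int k * (pi * t)) =
     (1/2) * (cos (pi * t) ^ m * cos (of_int (k + 1) * (pi * t)) + cos (pi * t) ^ m * cos (of_int (k - 1) * (pi * t)))" for t
  proof -
    have "cos (of_int (k + 1) * (pi * t)) + cos (of_int (k - 1) * (pi * t)) = 2 * (cos (of_int k * (pi * t)) * cos (pi * t))"
      using cos_add[of "of_int k * (pi * t)" "pi * t"] cos_diff[of "of_int k * (pi * t)" "pi * t"]
      by (simp add: algebra_simps)
    then show ?thesis by (simp flip: distrib_left)
  qed
  moreover have "exact_rule q T v (\<lambda>t. (1/2) * (cos (pi * t) ^ m * cos (of_int (k + 1) * (pi * t)) + cos (pi * t) ^ m * cos (of_int (k - 1) * (pi * t))))"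
    using Suc.prems by (intro exact_rule_scale exact_rule_add Suc.IH) auto
  ultimately show ?case by (simp only:)
qed

lemma exact_rule_cos_product:
  fixes a b :: real
  assumes base: "\<And>k::int. \<bar>k\<bar> \<le> D \<Longrightarrow> exact_rule q T v (\<lambda>t. cos (of_int k * (pi * t)))"
    and k: "a + b = of_int k" "int m + \<bar>k\<bar> \<le> D"
    and l: "a - b = of_int l" "int m + \<bar>l\<bar> \<le> D"
  shows "exact_rule q T v (\<lambda>t. cos (pi * t) ^ m * (cos (pi * a * t) * cos (pi * b * t)))"
proof -
  have "cos (pi * t) ^ m * (cos (pi * a * t) * cos (pi * b * t)) =
     (1/2) * (cos (pi * t) ^ m * cos (of_int k * (pi * t)) + cos (pi * t) ^ m * cos (of_int l * (pi * t)))" for t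
  proof -
    have "cos (of_int k * (pi * t)) + cos (of_int l * (pi * t)) = 2 * (cos (pi * a * t) * cos (pi * b * t))"
      unfolding k(1)[symmetric] l(1)[symmetric] using cos_times_cos[of "pi * a * t" "pi * b * t"]
      by (simp add: algebra_simps)
    then show ?thesis by (simp flip: distrib_left)
  qed
  moreover have "exact_rule q T v (\<lambda>t. (1/2) * (cos (pi * t) ^ m * cos (of_int k * (pi * t)) + cos (pi * t) ^ m * cos (of_int l * (pi * t))))"
    using exact_rule_cos_power[OF base k(2)] exact_rule_cos_power[OF base l(2)]
    by (intro exact_rule_scale exact_rule_add)
  ultimately show ?thesis by (simp only:)
qed

lemma integral_cos_multiple:
  "integral {0..1} (\<lambda>t. cos (of_int k * (pi * t))) = (if k = 0 then 1 else 0)"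
proof (cases "k = 0")
  case False
  have "((\<lambda>t. cos (of_int k * (pi * t))) has_integral
      (sin (of_int k * (pi * 1)) / (of_int k * pi) - sin (of_int k * (pi * 0)) / (of_int k * pi))) {0..1}"
    using False
    by (intro fundamental_theorem_of_calculus)
       (auto intro!: derivative_eq_intros simp: field_simps simp flip: has_real_derivative_iff_has_vector_derivative)
  moreover have "sin (of_int k * pi) = 0" by (simp add: sin_integer_2pi sin_zero_iff_int2)
  ultimately show ?thesis using False by (simp add: integral_unique)
qed simp

text \<open>
  The terms telescope: \<open>2 sin \<alpha> cos ((2r + 1)\<alpha>) = sin ((2r + 2)\<alpha>) - sin (2r\<alpha>)\<close>.
\<close>
lemma sum_cos_odd_multiples:
  "2 * sin \<alpha> * (\<Sum>r<N. cos ((2 * real r + 1) * \<alpha>)) = sin (2 * real N * \<alpha>)"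
proof (induction N)
  case (Suc N)
  have "2 * sin \<alpha> * cos ((2 * real N + 1) * \<alpha>) = sin (2 * real (Suc N) * \<alpha>) - sin (2 * real N * \<alpha>)"
    using sin_add[of "(2 * real N + 1) * \<alpha>" \<alpha>] sin_diff[of "(2 * real N + 1) * \<alpha>" \<alpha>]
    by (simp add: algebra_simps)
  then show ?case using Suc by (simp add: distrib_left)
qed simp

lemma sin_rational_multiple_nonzero:
  assumes "k \<noteq> 0" "\<bar>k\<bar> < int M"
  shows "sin (of_int k * pi / real M) \<noteq> 0"
proof
  assume "sin (of_int k * pi / real M) = 0"
  then obtain i :: int where "of_int k * pi / real M = of_int i * pi" by (auto simp: sin_zero_iff_int2)
  then have "real_of_int k = of_int (i * int M)" using assms by (simp add: field_simps)
  then have "k = i * int M" by (simp only: of_int_eq_iff)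
  then have "int M dvd k" by simp
  then show False using assms zdvd_imp_le[of "int M" "\<bar>k\<bar>"] by auto
qed

lemma sum_image_nodes:
  assumes "strict_mono a"
  shows "(\<Sum>t\<in>a ` {0..<int N}. h t) = (\<Sum>r<N. h (a (int r)))"
proof -
  have "{0..<int N} = int ` {..<N}" using image_int_atLeastLessThan[of 0 N] by (simp add: atLeast0LessThan)
  moreover have "inj a" by (rule strict_mono_imp_inj_on[OF assms])
  ultimately show ?thesis
    by (simp add: sum.reindex inj_on_subset[of a UNIV] image_image[symmetric] comp_def inj_on_def del: image_image)
qed

definition node1_II :: "nat \<Rightarrow> int \<Rightarrow> real" where
  "node1_II N r = (of_int r + 1/2) / real N"

definition node1_VIII :: "nat \<Rightarrow> int \<Rightarrow> real" where
  "node1_VIII N r = 2 * (of_int r + 1/2) / (2 * real N + 1)"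

lemma strict_mono_node1:
  "N > 0 \<Longrightarrow> strict_mono (node1_II N)" "strict_mono (node1_VIII N)"
  by (auto intro!: strict_monoI simp: node1_II_def node1_VIII_def divide_strict_right_mono)

lemma node1_01:
  assumes "0 \<le> r" "r < int N"
  shows "0 \<le> node1_II N r \<and> node1_II N r \<le> 1" "0 \<le> node1_VIII N r \<and> node1_VIII N r \<le> 1"
proof -
  have "real_of_int r \<le> real N - 1" using assms by linarith
  then show "0 \<le> node1_II N r \<and> node1_II N r \<le> 1" "0 \<le> node1_VIII N r \<and> node1_VIII N r \<le> 1"
    using assms by (auto simp: node1_II_def node1_VIII_def field_simps)
qed

text \<open>
  The nodes are odd multiples of \<open>1/(2N)\<close>. The sum over them vanishes because its telescoped value is
  \<open>sin (k\<pi>)\<close>, where the divisor \<open>sin (k\<pi>/(2N))\<close> is nonzero for \<open>0 < \<bar>k\<bar> < 2N\<close>.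
\<close>
lemma exact_rule_II:
  assumes N: "N > 0" and k: "\<bar>k\<bar> \<le> 2 * int N - 1"
  shows "exact_rule (1 / real N) (node1_II N ` {0..<int N}) 0 (\<lambda>t. cos (of_int k * (pi * t)))"
proof -
  have "(\<Sum>r<N. cos (of_int k * (pi * node1_II N (int r)))) = (if k = 0 then real N else 0)"
  proof (cases "k = 0")
    case False
    define \<alpha> where "\<alpha> = of_int k * pi / real (2 * N)"
    have "of_int k * (pi * node1_II N (int r)) = (2 * real r + 1) * \<alpha>" for r
      using N by (simp add: \<alpha>_def node1_II_def field_simps)
    moreover have "sin (2 * real N * \<alpha>) = 0"
      using N by (simp add: \<alpha>_def sin_zero_iff_int2)
    moreover have "sin \<alpha> \<noteq> 0"
      unfolding \<alpha>_def using False k by (intro sin_rational_multiple_nonzero) auto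
    ultimately show ?thesis using sum_cos_odd_multiples[of \<alpha> N] False by simp
  qed simp
  then show ?thesis using N
    by (auto simp: exact_rule_def integral_cos_multiple sum_image_nodes strict_mono_node1 intro!: continuous_intros)
qed

text \<open>
  The nodes are odd multiples of \<open>1/(2N+1)\<close>. With \<open>\<alpha> = k\<pi>/(2N+1)\<close> the telescoped value is
  \<open>sin (k\<pi> - \<alpha>) = - cos (k\<pi>) sin \<alpha>\<close>, which the end point compensates.
\<close>
lemma exact_rule_VIII:
  assumes k: "\<bar>k\<bar> \<le> 2 * int N"
  shows "exact_rule (2 / (2 * real N + 1)) (node1_VIII N ` {0..<int N}) (1 / (2 * real N + 1))
    (\<lambda>t. cos (of_int k * (pi * t)))"
proof -
  have "2 * (\<Sum>r<N. cos (of_int k * (pi * node1_VIII N (int r)))) + cos (of_int k * pi)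
      = (if k = 0 then 2 * real N + 1 else 0)"
  proof (cases "k = 0")
    case False
    define \<alpha> where "\<alpha> = of_int k * pi / real (2 * N + 1)"
    have nodes: "of_int k * (pi * node1_VIII N (int r)) = (2 * real r + 1) * \<alpha>" for r
      by (simp add: \<alpha>_def node1_VIII_def field_simps)
    have "(2 * real N + 1) * \<alpha> = of_int k * pi" by (simp add: \<alpha>_def field_simps)
    then have "2 * real N * \<alpha> = of_int k * pi - \<alpha>" by (simp add: algebra_simps)
    then have "sin (2 * real N * \<alpha>) = - cos (of_int k * pi) * sin \<alpha>"
      by (simp add: sin_diff sin_zero_iff_int2)
    with sum_cos_odd_multiples[of \<alpha> N]
    have "sin \<alpha> * (2 * (\<Sum>r<N. cos ((2 * real r + 1) * \<alpha>)) + cos (of_int k * pi)) = 0"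
      by (simp add: algebra_simps)
    moreover have "sin \<alpha> \<noteq> 0"
      unfolding \<alpha>_def using False k by (intro sin_rational_multiple_nonzero) auto
    ultimately show ?thesis using False by (simp add: nodes)
  qed simp
  then have "(2 * (\<Sum>r<N. cos (of_int k * (pi * node1_VIII N (int r)))) + cos (of_int k * pi)) / (2 * real N + 1)
      = (if k = 0 then 1 else 0)"
    by simp
  then show ?thesis
    by (auto simp: exact_rule_def integral_cos_multiple sum_image_nodes strict_mono_node1 add_divide_distrib intro!: continuous_intros)
qed

section \<open>The four cubature formulas\<close>

lemma F_grids:
  fixes N :: nat
  shows "N > 0 \<Longrightarrow> F_II_plus N = (F \<inter> grid (node1_II N ` {0..<int N}) :: (real^'n::{finite,wellorder}) set)"
    "N > 0 \<Longrightarrow> F_II_minus N = {s :: real^'n::_. s \<in> F \<inter> grid (node1_II N ` {0..<int N}) \<and> inj (($) s)}"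
    "F_VIII_plus N = (F \<inter> grid (node1_VIII N ` {0..<int N}) :: (real^'n::_) set)"
    "F_VIII_minus N = {s :: real^'n::_. s \<in> F \<inter> grid (node1_VIII N ` {0..<int N}) \<and> inj (($) s)}"
proof -
  have "node_II N = (\<lambda>r::int^'n::_. \<chi> i. node1_II N (r $ i))"
    "node_VIII N = (\<lambda>r::int^'n::_. \<chi> i. node1_VIII N (r $ i))"
    by (auto simp: node_II_def node_VIII_def node1_II_def node1_VIII_def fun_eq_iff)
  note eqs = F_II_plus_def F_II_minus_def F_VIII_plus_def F_VIII_minus_def this
  show "N > 0 \<Longrightarrow> F_II_plus N = (F \<inter> grid (node1_II N ` {0..<int N}) :: (real^'n::_) set)"
    "N > 0 \<Longrightarrow> F_II_minus N = {s :: real^'n::_. s \<in> F \<inter> grid (node1_II N ` {0..<int N}) \<and> inj (($) s)}"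
    unfolding eqs by (rule nodes_D_plus[OF strict_mono_node1(1) node1_01(1)]; assumption)+
  show "F_VIII_plus N = (F \<inter> grid (node1_VIII N ` {0..<int N}) :: (real^'n::_) set)"
    "F_VIII_minus N = {s :: real^'n::_. s \<in> F \<inter> grid (node1_VIII N ` {0..<int N}) \<and> inj (($) s)}"
    unfolding eqs by (rule nodes_D_plus[OF strict_mono_node1(2) node1_01(2)]; assumption)+
qed

abbreviation cos_factor_products :: "real^'n \<Rightarrow> (real \<Rightarrow> real) set" where
  "cos_factor_products l \<equiv> {\<lambda>t. cos (pi * l $ i * t) * cos (pi * l $ j * t) |i j. True}"

lemma separable_square:
  assumes "separable (cos_factors l) g"
  shows "separable (cos_factor_products l) (\<lambda>x. (g x)\<^sup>2)"
  unfolding power2_eq_square by (rule separable_mult[OF _ assms assms]) auto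

lemma degree_at_most_negative:
  assumes "degree_at_most f d" "d < 0"
  shows "f = 0"
proof -
  have "Poly_Mapping.keys f = {}"
    using assms unfolding degree_at_most_def by (metis all_not_in_conv of_nat_0_le_iff order_le_less_trans not_less)
  then show ?thesis by simp
qed

lemma rho1_combinations:
  "rho1 $ (i::'n::{finite,wellorder}) + rho1 $ j = of_int (int (card {k. i < k}) + int (card {k. j < k}))"
  "rho1 $ (i::'n) - rho1 $ j = of_int (int (card {k. i < k}) - int (card {k. j < k}))"
  by (simp_all add: rho1_def)

lemma rho2_combinations:
  "rho2 $ (i::'n::{finite,wellorder}) + rho2 $ j = of_int (int (card {k. i < k}) + int (card {k. j < k}) + 1)"
  "rho2 $ (i::'n) - rho2 $ j = of_int (int (card {k. i < k}) - int (card {k. j < k}))"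
  by (simp_all add: rho2_def)

lemma card_greater_less: "card {k. (i::'n::{finite,wellorder}) < k} < CARD('n)"
  by (intro psubset_card_mono) auto

text \<open>
  A cosine of half-integral frequency vanishes at the end point \<open>1\<close>, which removes that node from the
  rule of type VIII.
\<close>
lemma cos_half_odd_pi: "cos (pi * (real m + 1/2) * 1) = 0"
  by (simp add: distrib_left cos_add)

lemma eval_special_polys:
  fixes x :: "real^'n::{finite,wellorder}"
  assumes "x \<in> F"
  shows "eval_rpoly J_I_minus (phi x) = (cos_minus rho1 x)\<^sup>2"
    "eval_rpoly J_III_plus (phi x) = (cos_plus rho x)\<^sup>2"
    "eval_rpoly J_III_minus (phi x) = (cos_minus rho2 x)\<^sup>2"
  unfolding J_I_minus_def J_III_plus_def J_III_minus_def
  by (intro eval_poly_via_phi assms poly_in_phi_cos_minus_sq poly_in_phi_cos_plus_rho_sq;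
      simp only: rho1_combinations rho2_combinations Ints_of_int)+

lemma finite_node1: "finite (node1_II N ` {0..<int N})" "finite (node1_VIII N ` {0..<int N})"
  and node1_subset: "node1_II N ` {0..<int N} \<subseteq> {0..1}" "node1_VIII N ` {0..<int N} \<subseteq> {0..1}"
  using node1_01 by auto

lemma continuous_cos_factor_product: "u \<in> cos_factor_products l \<Longrightarrow> continuous_on UNIV u"
  by (auto intro!: continuous_on_mult continuous_on_cos continuous_on_id continuous_on_const)

lemma cubature_I_plus:
  fixes f :: "'n::{finite,wellorder} rpoly"
  assumes N: "N > 0" and deg: "degree_at_most f (2 * int N - 1)"
  shows "set_integrable lebesgue FF (\<lambda>Y. eval_rpoly f Y * omega_I_plus Y)"
    and "(LINT Y:FF|lebesgue. eval_rpoly f Y * omega_I_plus Y)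
          = (1 / real N) ^ CARD('n) * (\<Sum>Y\<in>FF_II_plus N. inverse (real (HH Y)) * eval_rpoly f Y)"
proof -
  have deg': "degree_at_most f (int (2 * N - 1))" using deg N by (simp add: of_nat_diff)
  have sep: "separable {\<lambda>t. 1} (\<lambda>x::real^'n::_. 1)"
    using separable.prod[of "\<lambda>_ _. 1" "{\<lambda>t. 1}"] by simp
  have exact: "integral {0..1} (\<lambda>t. cos (pi * t) ^ m * u t)
      = 1 / real N * (\<Sum>t\<in>node1_II N ` {0..<int N}. cos (pi * t) ^ m * u t)"
    if "u \<in> {\<lambda>t. 1}" "m \<le> 2 * N - 1" for u m
  proof -
    have "int m + \<bar>0\<bar> \<le> 2 * int N - 1" using that(2) N by linarith
    from exact_rule_cos_power[OF exact_rule_II[OF N] this] that(1) show ?thesis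
      by (simp add: exact_rule_def)
  qed
  \<comment> \<open>The weight is the constant polynomial \<open>1\<close>.\<close>
  let ?one = "Poly_Mapping.single 0 1 :: 'n rpoly"
  have one: "eval_rpoly ?one Y = 1" for Y
    unfolding eval_rpoly_single by simp
  have cont: "continuous_on UNIV u" if "u \<in> {\<lambda>t. 1}" for u :: "real \<Rightarrow> real"
    using that by simp
  note C = cubature_FF[OF deg' finite_node1(1) node1_subset(1) sep refl cont exact one]
  show "set_integrable lebesgue FF (\<lambda>Y. eval_rpoly f Y * omega_I_plus Y)"
    using C(1) unfolding one omega_I_plus_def .
  show "(LINT Y:FF|lebesgue. eval_rpoly f Y * omega_I_plus Y)
      = (1 / real N) ^ CARD('n) * (\<Sum>Y\<in>FF_II_plus N. inverse (real (HH Y)) * eval_rpoly f Y)"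
    using C(2) unfolding one omega_I_plus_def FF_II_plus_def F_grids(1)[OF N] mult_1_right .
qed

lemma cubature_III_plus:
  fixes f :: "'n::{finite,wellorder} rpoly"
  assumes N: "N > 0" and deg: "degree_at_most f (2 * int N - 1)"
  shows "set_integrable lebesgue FF (\<lambda>Y. eval_rpoly f Y * omega_III_plus Y)"
    and "(LINT Y:FF|lebesgue. eval_rpoly f Y * omega_III_plus Y)
          = (2 / (2 * real N + 1)) ^ CARD('n)
            * (\<Sum>Y\<in>FF_VIII_plus N. inverse (real (HH Y)) * eval_rpoly f Y * eval_rpoly J_III_plus Y)"
proof -
  have deg': "degree_at_most f (int (2 * N - 1))" using deg N by (simp add: of_nat_diff)
  have sym: "(cos_plus rho (permute_coords \<sigma> x))\<^sup>2 = (cos_plus rho x)\<^sup>2"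
    if "\<sigma> permutes UNIV" for \<sigma> and x :: "real^'n::_"
    using prod.reindex_bij_betw[OF permutes_bij[OF that], of "\<lambda>i. cos (pi * (1/2) * x $ i)"]
    by (simp add: cos_plus_rho)
  have exact: "integral {0..1} (\<lambda>t. cos (pi * t) ^ m * u t)
      = 2 / (2 * real N + 1) * (\<Sum>t\<in>node1_VIII N ` {0..<int N}. cos (pi * t) ^ m * u t)"
    if u: "u \<in> cos_factor_products (rho :: real^'n::_)" and m: "m \<le> 2 * N - 1" for u m
  proof -
    have u: "u = (\<lambda>t. cos (pi * (1/2) * t) * cos (pi * (1/2) * t))" using u by (auto simp: rho_def)
    have bounds: "int m + \<bar>1\<bar> \<le> 2 * int N" "int m + \<bar>0\<bar> \<le> 2 * int N" using m N by linarith+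
    have "exact_rule (2 / (2 * real N + 1)) (node1_VIII N ` {0..<int N}) (1 / (2 * real N + 1))
        (\<lambda>t. cos (pi * t) ^ m * u t)"
      unfolding u by (rule exact_rule_cos_product[OF exact_rule_VIII _ bounds(1) _ bounds(2)]) simp_all
    moreover have "u 1 = 0" by (simp add: u)
    ultimately show ?thesis by (simp add: exact_rule_def)
  qed
  note C = cubature_FF[OF deg' finite_node1(2) node1_subset(2) separable_square[OF separable_cos_plus]
      sym continuous_cos_factor_product exact eval_special_polys(2)]
  show "set_integrable lebesgue FF (\<lambda>Y. eval_rpoly f Y * omega_III_plus Y)"
    using C(1) unfolding omega_III_plus_def .
  show "(LINT Y:FF|lebesgue. eval_rpoly f Y * omega_III_plus Y)
      = (2 / (2 * real N + 1)) ^ CARD('n)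
        * (\<Sum>Y\<in>FF_VIII_plus N. inverse (real (HH Y)) * eval_rpoly f Y * eval_rpoly J_III_plus Y)"
    using C(2) unfolding omega_III_plus_def FF_VIII_plus_def F_grids(3) .
qed

lemma card_greater_le: "int (card {k. (i::'n::{finite,wellorder}) < k}) \<le> int CARD('n) - 1"
  using card_greater_less[of i] by linarith

lemma cubature_I_minus:
  fixes f :: "'n::{finite,wellorder} rpoly"
  assumes N: "N \<ge> CARD('n)" and deg: "degree_at_most f (2 * (int N - int CARD('n)) + 1)"
  shows "set_integrable lebesgue FF (\<lambda>Y. eval_rpoly f Y * omega_I_minus Y)"
    and "(LINT Y:FF|lebesgue. eval_rpoly f Y * omega_I_minus Y)
          = (1 / real N) ^ CARD('n) * (\<Sum>Y\<in>FF_II_minus N. eval_rpoly f Y * eval_rpoly J_I_minus Y)"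
proof -
  have N0: "N > 0" using N zero_less_card_finite[where 'a = 'n] by linarith
  have "int (2 * (N - CARD('n)) + 1) = 2 * (int N - int CARD('n)) + 1"
    using N by (simp add: of_nat_diff)
  then have deg': "degree_at_most f (int (2 * (N - CARD('n)) + 1))" using deg by (simp only:)
  have exact: "integral {0..1} (\<lambda>t. cos (pi * t) ^ m * u t)
      = 1 / real N * (\<Sum>t\<in>node1_II N ` {0..<int N}. cos (pi * t) ^ m * u t)"
    if u: "u \<in> cos_factor_products (rho1 :: real^'n::_)" and m: "m \<le> 2 * (N - CARD('n)) + 1" for u m
  proof -
    obtain i j :: 'n where u: "u = (\<lambda>t. cos (pi * rho1 $ i * t) * cos (pi * rho1 $ j * t))"
      using u by blast
    let ?a = "int (card {k. i < k})" and ?b = "int (card {k. j < k})"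
    have bounds: "int m + \<bar>?a + ?b\<bar> \<le> 2 * int N - 1" "int m + \<bar>?a - ?b\<bar> \<le> 2 * int N - 1"
      using m N card_greater_le[of i] card_greater_le[of j] by linarith+
    show ?thesis
      using exact_rule_cos_product[OF exact_rule_II[OF N0] rho1_combinations(1) bounds(1) rho1_combinations(2) bounds(2)]
      by (simp add: exact_rule_def u)
  qed
  have zero: "eval_rpoly J_I_minus (phi s) = 0" if "s \<in> F" "\<not> inj (($) s)" for s :: "real^'n::_"
    using that by (simp add: eval_special_polys cos_minus_eq_0)
  note C = cubature_FF[OF deg' finite_node1(1) node1_subset(1) separable_square[OF separable_cos_minus]
      cos_minus_sq_permute continuous_cos_factor_product exact eval_special_polys(1)]
  show "set_integrable lebesgue FF (\<lambda>Y. eval_rpoly f Y * omega_I_minus Y)"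
    using C(1) unfolding omega_I_minus_def .
  have lint: "(LINT Y:FF|lebesgue. eval_rpoly f Y * omega_I_minus Y) = (1 / real N) ^ CARD('n)
      * (\<Sum>Y\<in>phi ` (F \<inter> grid (node1_II N ` {0..<int N})). inverse (real (HH Y)) * eval_rpoly f Y * eval_rpoly J_I_minus Y)"
    using C(2) unfolding omega_I_minus_def .
  have strict: "(\<Sum>Y\<in>phi ` (F \<inter> grid (node1_II N ` {0..<int N})). inverse (real (HH Y)) * eval_rpoly f Y * eval_rpoly J_I_minus Y)
      = (\<Sum>Y\<in>phi ` {s \<in> F \<inter> grid (node1_II N ` {0..<int N}). inj (($) s)}. eval_rpoly f Y * eval_rpoly J_I_minus Y)"
    by (rule sum_strict_nodes[OF finite_node1(1) zero])
  show "(LINT Y:FF|lebesgue. eval_rpoly f Y * omega_I_minus Y)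
      = (1 / real N) ^ CARD('n) * (\<Sum>Y\<in>FF_II_minus N. eval_rpoly f Y * eval_rpoly J_I_minus Y)"
    using lint unfolding strict FF_II_minus_def F_grids(2)[OF N0] .
qed

lemma cubature_III_minus:
  fixes f :: "'n::{finite,wellorder} rpoly"
  assumes N: "N \<ge> CARD('n)" and deg: "degree_at_most f (2 * (int N - int CARD('n)) + 1)"
  shows "set_integrable lebesgue FF (\<lambda>Y. eval_rpoly f Y * omega_III_minus Y)"
    and "(LINT Y:FF|lebesgue. eval_rpoly f Y * omega_III_minus Y)
          = (2 / (2 * real N + 1)) ^ CARD('n)
            * (\<Sum>Y\<in>FF_VIII_minus N. eval_rpoly f Y * eval_rpoly J_III_minus Y)"
proof -
  have "int (2 * (N - CARD('n)) + 1) = 2 * (int N - int CARD('n)) + 1"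
    using N by (simp add: of_nat_diff)
  then have deg': "degree_at_most f (int (2 * (N - CARD('n)) + 1))" using deg by (simp only:)
  have exact: "integral {0..1} (\<lambda>t. cos (pi * t) ^ m * u t)
      = 2 / (2 * real N + 1) * (\<Sum>t\<in>node1_VIII N ` {0..<int N}. cos (pi * t) ^ m * u t)"
    if u: "u \<in> cos_factor_products (rho2 :: real^'n::_)" and m: "m \<le> 2 * (N - CARD('n)) + 1" for u m
  proof -
    obtain i j :: 'n where u: "u = (\<lambda>t. cos (pi * rho2 $ i * t) * cos (pi * rho2 $ j * t))"
      using u by blast
    let ?a = "int (card {k. i < k})" and ?b = "int (card {k. j < k})"
    have bounds: "int m + \<bar>?a + ?b + 1\<bar> \<le> 2 * int N" "int m + \<bar>?a - ?b\<bar> \<le> 2 * int N"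
      using m N card_greater_le[of i] card_greater_le[of j] by linarith+
    have "cos (pi * rho2 $ i * 1) = 0" using cos_half_odd_pi by (simp add: rho2_def)
    then have "u 1 = 0" by (simp add: u)
    then show ?thesis
      using exact_rule_cos_product[OF exact_rule_VIII rho2_combinations(1) bounds(1) rho2_combinations(2) bounds(2)]
      by (simp add: exact_rule_def u)
  qed
  have zero: "eval_rpoly J_III_minus (phi s) = 0" if "s \<in> F" "\<not> inj (($) s)" for s :: "real^'n::_"
    using that by (simp add: eval_special_polys cos_minus_eq_0)
  note C = cubature_FF[OF deg' finite_node1(2) node1_subset(2) separable_square[OF separable_cos_minus]
      cos_minus_sq_permute continuous_cos_factor_product exact eval_special_polys(3)]
  show "set_integrable lebesgue FF (\<lambda>Y. eval_rpoly f Y * omega_III_minus Y)"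
    using C(1) unfolding omega_III_minus_def .
  have lint: "(LINT Y:FF|lebesgue. eval_rpoly f Y * omega_III_minus Y) = (2 / (2 * real N + 1)) ^ CARD('n)
      * (\<Sum>Y\<in>phi ` (F \<inter> grid (node1_VIII N ` {0..<int N})). inverse (real (HH Y)) * eval_rpoly f Y * eval_rpoly J_III_minus Y)"
    using C(2) unfolding omega_III_minus_def .
  have strict: "(\<Sum>Y\<in>phi ` (F \<inter> grid (node1_VIII N ` {0..<int N})). inverse (real (HH Y)) * eval_rpoly f Y * eval_rpoly J_III_minus Y)
      = (\<Sum>Y\<in>phi ` {s \<in> F \<inter> grid (node1_VIII N ` {0..<int N}). inj (($) s)}. eval_rpoly f Y * eval_rpoly J_III_minus Y)"
    by (rule sum_strict_nodes[OF finite_node1(2) zero])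
  show "(LINT Y:FF|lebesgue. eval_rpoly f Y * omega_III_minus Y)
      = (2 / (2 * real N + 1)) ^ CARD('n)
        * (\<Sum>Y\<in>FF_VIII_minus N. eval_rpoly f Y * eval_rpoly J_III_minus Y)"
    using lint unfolding strict FF_VIII_minus_def F_grids(4) .
qed

theorem theorem5p2:
  fixes N :: nat and f :: "'n::{finite,wellorder} rpoly"
  assumes "N > 0"
  shows
    "(degree_at_most f (2 * int N - 1) \<longrightarrow>
       (set_integrable lebesgue FF (\<lambda>Y. eval_rpoly f Y * omega_I_plus Y) \<and>
        (LINT Y:FF|lebesgue. eval_rpoly f Y * omega_I_plus Y)
          = (1 / real N) ^ CARD('n)
            * (\<Sum>Y\<in>FF_II_plus N. inverse (real (HH Y)) * eval_rpoly f Y)) \<and>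
       (set_integrable lebesgue FF (\<lambda>Y. eval_rpoly f Y * omega_III_plus Y) \<and>
        (LINT Y:FF|lebesgue. eval_rpoly f Y * omega_III_plus Y)
          = (2 / (2 * real N + 1)) ^ CARD('n)
            * (\<Sum>Y\<in>FF_VIII_plus N.
                 inverse (real (HH Y)) * eval_rpoly f Y * eval_rpoly J_III_plus Y))) \<and>
     (degree_at_most f (2 * (int N - int CARD('n)) + 1) \<longrightarrow>
       (set_integrable lebesgue FF (\<lambda>Y. eval_rpoly f Y * omega_I_minus Y) \<and>
        (LINT Y:FF|lebesgue. eval_rpoly f Y * omega_I_minus Y)
          = (1 / real N) ^ CARD('n)
            * (\<Sum>Y\<in>FF_II_minus N. eval_rpoly f Y * eval_rpoly J_I_minus Y)) \<and>
       (set_integrable lebesgue FF (\<lambda>Y. eval_rpoly f Y * omega_III_minus Y) \<and>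
        (LINT Y:FF|lebesgue. eval_rpoly f Y * omega_III_minus Y)
          = (2 / (2 * real N + 1)) ^ CARD('n)
            * (\<Sum>Y\<in>FF_VIII_minus N. eval_rpoly f Y * eval_rpoly J_III_minus Y)))"
proof (cases "N < CARD('n)")
  case True
  \<comment> \<open>The bound on the degree is negative, so \<open>f = 0\<close> and both sides of the antisymmetric formulas vanish.\<close>
  have "2 * (a - b) + 1 < 0" if "a < b" for a b :: int using that by presburger
  from this[of "int N" "int CARD('n)"] True
  have "f = 0" if "degree_at_most f (2 * (int N - int CARD('n)) + 1)"
    using degree_at_most_negative[OF that] by simp
  then show ?thesis using cubature_I_plus[OF assms] cubature_III_plus[OF assms]
    by (auto simp: set_integrable_def set_lebesgue_integral_def)
next
  case False
  then have "CARD('n) \<le> N" by simp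
  then show ?thesis
    by (intro conjI impI cubature_I_plus[OF assms] cubature_III_plus[OF assms] cubature_I_minus cubature_III_minus)
qed

end
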